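(* Let $d_1, d_2$ be positive integers (possibly depending on the input size $n$). If there is a $T(n)$-time algorithm for the $(d_1/2, 2d_2)$-$\mathrm{VC}$-$\mathrm{Ldim}$ Problem, then there is an $O(T(n))$-time (randomized) algorithm for the $(d_1, d_2)$-Gap Exponential Biclique Problem.
   Context: Promise problems: a promise problem consists of two disjoint languages $L_{YES}, L_{NO}$. A randomized algorithm $\mathbb{A}$ solves it if $\Pr[\mathbb{A}(x)=YES]\ge 2/3$ for all $x\in L_{YES}$ and $\Pr[\mathbb{A}(x)=NO]\ge 2/3$ for all $x\in L_{NO}$; on other inputs its output is arbitrary. All algorithms for promise problems here may be randomized. The size $n$ of an instance is the size of the given binary matrix (the matrix of the concept class, respectively the bipartite $|A|\times|B|$ adjacency matrix). As usual, $T(n)$ is at least linear in $n$. $K_{a,b}$: a bipartite graph $G=(A,B,E)$ contains $K_{a,b}$ if there are $S\subseteq A$ with $|S|=a$ and $T\subseteq B$ with $|T|=b$ such that $(s,t)\in E$ for all $s\in S,t\in T$; otherwise $G$ is $K_{a,b}$-free. $(t_1,t_2)$-Gap Exponential Biclique Problem: given a bipartite graph $G=(A,B,E)$, distinguish between (YES) $G$ contains $K_{t_1,2^{t_1}}$ and (NO) $G$ is $K_{t_2,2^{t_2}}$-free. $(d_1,d_2)$-$\mathrm{VC}$-$\mathrm{Ldim}$ Problem: given a concept class $\mathcal{C}$ (a set of functions $X\to\{0,1\}$) explicitly as a binary $|X|\times|\mathcal{C}|$ matrix, distinguish between (YES) $\mathrm{VC}(\mathcal{C})\ge d_1$ and (NO)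 $\mathrm{Ldim}(\mathcal{C})<d_2$. VC Dimension: $\mathrm{VC}(\mathcal{C})$ is the size of the largest $S\subseteq X$ such that $\mathcal{C}|_S := \{c|_S : c\in\mathcal{C}\}$ contains all functions $S\to\{0,1\}$. Littlestone's Dimension: an online learning algorithm $\mathbb{A}$, at each step $i$, is given a sample $x_i\in X$, must output a prediction $z_i\in\{0,1\}$ (based on $(x_1,y_1),\dots,(x_{i-1},y_{i-1})$ and $x_i$), and is then told the correct label $y_i\in\{0,1\}$. Its mistake bound on a sequence $(x_1,y_1),\dots,(x_T,y_T)$ (with the $x_i$ distinct) is $|\{i: z_i\neq y_i\}|$; its mistake bound for $\mathcal{C}$ is the maximum over all sequences realizable by $\mathcal{C}$ (i.e. there is $c\in\mathcal{C}$ with $y_i=c(x_i)$ for all $i$). $\mathrm{Ldim}(\mathcal{C})$ is the minimum, over all online algorithms, of the mistake bound for $\mathcal{C}$. *)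

theory Defs
  imports
    "HOL-Probability.Probability"
    "HOL-Library.FuncSet"
    "HOL-Library.Landau_Symbols"
    "Jordan_Normal_Form.Matrix"
begin

section \<open>Bicliques, VC dimension, Littlestone's dimension\<close>

definition contains_biclique ::
  "'a set \<Rightarrow> 'b set \<Rightarrow> ('a \<times> 'b) set \<Rightarrow> nat \<Rightarrow> nat \<Rightarrow> bool" where
  "contains_biclique A B E a b \<longleftrightarrow>
     (\<exists>S\<subseteq>A. \<exists>T\<subseteq>B. finite S \<and> finite T \<and> card S = a \<and> card T = b \<and> (\<forall>s\<in>S. \<forall>t\<in>T. (s, t) \<in> E))"

definition shatters :: "('a \<Rightarrow> bool) set \<Rightarrow> 'a set \<Rightarrow> bool" where
  "shatters C S \<longleftrightarrow> (S \<rightarrow>\<^sub>E UNIV) \<subseteq> (\<lambda>c. restrict c S) ` C"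

text \<open>
  Both dimensions are natural numbers and are meant for a finite domain \<open>X\<close>, where every
  supremum below is over a bounded set. On \<open>nat\<close> the supremum of the empty set is 0, so the
  empty class has both dimensions 0.
\<close>

definition VC :: "'a set \<Rightarrow> ('a \<Rightarrow> bool) set \<Rightarrow> nat" where
  "VC X C = (SUP S \<in> {S. S \<subseteq> X \<and> finite S \<and> shatters C S}. card S)"

text \<open>
  A (deterministic) online learner maps the labelled samples seen so far, oldest first, and the
  current sample to a prediction.
\<close>

type_synonym 'a learner = "('a \<times> bool) list \<Rightarrow> 'a \<Rightarrow> bool"

definition mistakes :: "'a learner \<Rightarrow> ('a \<times> bool) list \<Rightarrow> nat" where
  "mistakes L xys = card {i. i < length xys \<and> L (take i xys) (fst (xys ! i)) \<noteq> snd (xys ! i)}"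

definition realizable_seqs :: "'a set \<Rightarrow> ('a \<Rightarrow> bool) set \<Rightarrow> ('a \<times> bool) list set" where
  "realizable_seqs X C =
     {xys. distinct (map fst xys) \<and> fst ` set xys \<subseteq> X \<and> (\<exists>c\<in>C. \<forall>(x, y)\<in>set xys. y = c x)}"

definition mistake_bound :: "'a set \<Rightarrow> ('a \<Rightarrow> bool) set \<Rightarrow> 'a learner \<Rightarrow> nat" where
  "mistake_bound X C L = (SUP xys \<in> realizable_seqs X C. mistakes L xys)"

definition Ldim :: "'a set \<Rightarrow> ('a \<Rightarrow> bool) set \<Rightarrow> nat" where
  "Ldim X C = (INF L. mistake_bound X C L)"


section \<open>Instances and promise problems\<close>

text \<open>
  An instance of either problem is a binary matrix. Rows are the points of \<open>X\<close> (vertices of \<open>A\<close>),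
  columns are the concepts (vertices of \<open>B\<close>). Columns may coincide: the concept class is the set
  of all columns.
\<close>

definition inst_size :: "bool mat \<Rightarrow> nat" where
  "inst_size G = dim_row G * dim_col G"

definition points :: "bool mat \<Rightarrow> nat set" where
  "points G = {..<dim_row G}"

definition concepts :: "bool mat \<Rightarrow> (nat \<Rightarrow> bool) set" where
  "concepts G = (\<lambda>j. \<lambda>i\<in>points G. G $$ (i, j)) ` {..<dim_col G}"

definition edges :: "bool mat \<Rightarrow> (nat \<times> nat) set" where
  "edges G = {(i, j). i < dim_row G \<and> j < dim_col G \<and> G $$ (i, j)}"

text \<open>
  A promise problem is given by its sets of YES and NO instances. Disjointness of the two sets
  is not required. Parameters are functions of the instance size.
\<close>

record promise_problem =
  Yes :: "bool mat set"
  No :: "bool mat set"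

text \<open>
  The thresholds of this problem are real, so that \<open>d / 2\<close> is a legal threshold also for odd \<open>d\<close>.
\<close>

definition vc_ldim_problem :: "(nat \<Rightarrow> real) \<Rightarrow> (nat \<Rightarrow> real) \<Rightarrow> promise_problem" where
  "vc_ldim_problem d1 d2 =
     \<lparr> Yes = {G. real (VC (points G) (concepts G)) \<ge> d1 (inst_size G)},
       No = {G. real (Ldim (points G) (concepts G)) < d2 (inst_size G)} \<rparr>"

definition gap_exp_biclique_problem :: "(nat \<Rightarrow> nat) \<Rightarrow> (nat \<Rightarrow> nat) \<Rightarrow> promise_problem" where
  "gap_exp_biclique_problem t1 t2 =
     \<lparr> Yes = {G. contains_biclique {..<dim_row G} {..<dim_col G} (edges G)
                  (t1 (inst_size G)) (2 ^ t1 (inst_size G))},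
       No = {G. \<not> contains_biclique {..<dim_row G} {..<dim_col G} (edges G)
                  (t2 (inst_size G)) (2 ^ t2 (inst_size G))} \<rparr>"


section \<open>Randomized multitape Turing machines\<close>

text \<open>
  Tapes are two-way infinite. States, tapes and symbols are initial segments of the naturals.
  The transition function receives the state, the symbols under the heads and a fair coin toss;
  it yields the new state and, for each tape, the symbol to write and the head move.
\<close>

datatype move = Move_Left | Stay | Move_Right

fun shift :: "move \<Rightarrow> int" where
  "shift Move_Left = -1"
| "shift Stay = 0"
| "shift Move_Right = 1"

record tm =
  num_states :: nat
  num_tapes :: nat
  num_symbols :: nat
  start_state :: nat
  yes_state :: nat
  no_state :: nat
  delta :: "nat \<Rightarrow> nat list \<Rightarrow> bool \<Rightarrow> nat \<times> (nat \<times> move) list"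

text \<open>Symbol 0 is the blank, symbols 1, 2, 3 are the input alphabet.\<close>

definition wf_tm :: "tm \<Rightarrow> bool" where
  "wf_tm M \<longleftrightarrow>
     num_tapes M \<ge> 1 \<and> num_symbols M \<ge> 4 \<and>
     start_state M < num_states M \<and> yes_state M < num_states M \<and> no_state M < num_states M \<and>
     yes_state M \<noteq> no_state M \<and>
     (\<forall>q ss r. q < num_states M \<and> length ss = num_tapes M \<and> set ss \<subseteq> {..<num_symbols M} \<longrightarrow>
        fst (delta M q ss r) < num_states M \<and>
        length (snd (delta M q ss r)) = num_tapes M \<and>
        fst ` set (snd (delta M q ss r)) \<subseteq> {..<num_symbols M})"

text \<open>A tape is its content together with the head position.\<close>

type_synonym tape = "(int \<Rightarrow> nat) \<times> int"
type_synonym config = "nat \<times> tape list"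

definition read_tape :: "tape \<Rightarrow> nat" where
  "read_tape t = fst t (snd t)"

definition act_tape :: "tape \<Rightarrow> nat \<times> move \<Rightarrow> tape" where
  "act_tape t a = ((fst t)(snd t := fst a), snd t + shift (snd a))"

definition halted :: "tm \<Rightarrow> config \<Rightarrow> bool" where
  "halted M c \<longleftrightarrow> fst c \<in> {yes_state M, no_state M}"

definition next_config :: "tm \<Rightarrow> config \<Rightarrow> bool \<Rightarrow> config" where
  "next_config M c r =
     (let (q, as) = delta M (fst c) (map read_tape (snd c)) r in (q, map2 act_tape (snd c) as))"

definition step :: "tm \<Rightarrow> config \<Rightarrow> config pmf" where
  "step M c =
     (if halted M c then return_pmf c else map_pmf (next_config M c) (bernoulli_pmf (1 / 2)))"

primrec run :: "tm \<Rightarrow> nat \<Rightarrow> config \<Rightarrow> config pmf" where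
  "run M 0 c = return_pmf c"
| "run M (Suc k) c = bind_pmf (step M c) (run M k)"

text \<open>The input word is on tape 0, with the head on its first symbol; all other cells are blank.\<close>

definition input_tape :: "nat list \<Rightarrow> tape" where
  "input_tape w = (\<lambda>p. if 0 \<le> p \<and> p < int (length w) then w ! nat p else 0, 0)"

definition init_config :: "tm \<Rightarrow> nat list \<Rightarrow> config" where
  "init_config M w =
     (start_state M, input_tape w # replicate (num_tapes M - 1) (input_tape []))"

text \<open>
  Matrices are written row by row: 1 for a False entry, 2 for a True entry, 3 at the end of a row.
  The code of a matrix with at least one column has length at most \<open>2 * inst_size G\<close>.
\<close>

definition encode :: "bool mat \<Rightarrow> nat list" where
  "encode G =
     concat (map (\<lambda>i. map (\<lambda>j. if G $$ (i, j) then 2 else 1) [0..<dim_col G] @ [3])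
       [0..<dim_row G])"

text \<open>The probability of ever halting in state \<open>q\<close>, for a halting state \<open>q\<close>.\<close>

definition prob_halt_in :: "tm \<Rightarrow> bool mat \<Rightarrow> nat \<Rightarrow> real" where
  "prob_halt_in M G q =
     (SUP k. measure_pmf.prob (run M k (init_config M (encode G))) {c. fst c = q})"

definition solves :: "tm \<Rightarrow> promise_problem \<Rightarrow> bool" where
  "solves M P \<longleftrightarrow>
     (\<forall>G\<in>Yes P. prob_halt_in M G (yes_state M) \<ge> 2 / 3) \<and>
     (\<forall>G\<in>No P. prob_halt_in M G (no_state M) \<ge> 2 / 3)"

text \<open>Time is worst case over all inputs, promised or not, and over all coin tosses.\<close>

definition runs_in_time :: "tm \<Rightarrow> (nat \<Rightarrow> nat) \<Rightarrow> bool" where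
  "runs_in_time M T \<longleftrightarrow>
     (\<forall>G. \<forall>c \<in> set_pmf (run M (T (inst_size G)) (init_config M (encode G))). halted M c)"

definition solvable_in_time :: "promise_problem \<Rightarrow> (nat \<Rightarrow> nat) \<Rightarrow> bool" where
  "solvable_in_time P T \<longleftrightarrow> (\<exists>M. wf_tm M \<and> runs_in_time M T \<and> solves M P)"

end

theory Submission
  imports Defs
begin

text \<open>
  Delete every edge of \<open>G\<close> independently with probability 1/2 and read the result as a concept class
  of the same size.

  If \<open>G\<close> contains \<open>K\<close> with parts of size \<open>d1\<close> and \<open>2^d1\<close>, fix \<open>m = \<lceil>d1/2\<rceil>\<close> of the \<open>d1\<close> points. A fixed
  pattern on them is missed by all \<open>2^d1\<close> columns with probability \<open>(1 - 2^-m)^(2^d1)\<close>, so by a union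
  bound the points are shattered with probability at least 1/2.

  If \<open>G\<close> contains no such biclique for \<open>d2\<close>, the masked class has Littlestone dimension less than
  \<open>2 * d2\<close> for every outcome of the mask: a learner predicts False until it has seen \<open>d2\<close> points
  labelled True, which costs \<open>d2\<close> mistakes and leaves fewer than \<open>2^d2\<close> concepts, and then takes
  the majority of these, which costs fewer than \<open>d2\<close> further mistakes.

  Since both errors must be at most 1/3, the given machine is run three times on each of seven
  independently masked matrices. The new machine accepts if all three runs on some matrix accept.
\<close>

section \<open>Composition of randomized Turing machines\<close>

definition answer_state :: "tm \<Rightarrow> bool \<Rightarrow> nat" where
  "answer_state M b = (if b then yes_state M else no_state M)"

text \<open>Running time and answer law in one predicate: as \<open>D\<close> is a law on Booleans,
  all mass sits in the two halting states from time \<open>t\<close> on. Only states are compared,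
  so the final tapes stay unrestricted.\<close>

definition decides :: "tm \<Rightarrow> config \<Rightarrow> nat \<Rightarrow> bool pmf \<Rightarrow> bool" where
  "decides M c t D \<longleftrightarrow> (\<forall>n\<ge>t. map_pmf fst (run M n c) = map_pmf (answer_state M) D)"

lemma run_halted: "halted M c \<Longrightarrow> run M n c = return_pmf c"
  by (induction n) (auto simp: step_def bind_return_pmf)

lemma run_add: "run M (m + n) c = bind_pmf (run M m c) (run M n)"
  by (induction m arbitrary: c)
    (auto simp: bind_return_pmf bind_assoc_pmf intro!: bind_pmf_cong simp del: split_paired_All)

lemma run_Suc_coin:
  "\<not> halted M c \<Longrightarrow>
   run M (Suc n) c = bind_pmf (bernoulli_pmf (1/2)) (\<lambda>r. run M n (next_config M c r))"
  by (simp add: step_def bind_map_pmf)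

lemma run_Suc_const:
  "\<not> halted M c \<Longrightarrow> (\<And>r. next_config M c r = c') \<Longrightarrow> run M (Suc n) c = run M n c'"
  by (simp add: run_Suc_coin del: run.simps)

lemma decides_mono: "decides M c t D \<Longrightarrow> t \<le> t' \<Longrightarrow> decides M c t' D"
  by (auto simp: decides_def)

lemma halted_iff_answer: "halted M c \<longleftrightarrow> (\<exists>b. fst c = answer_state M b)"
  by (auto simp: halted_def answer_state_def)

lemma decides_answer: "fst c = answer_state M b \<Longrightarrow> decides M c t (return_pmf b)"
  by (auto simp: decides_def run_halted[OF halted_iff_answer[THEN iffD2, OF exI]])

text \<open>Equal laws have equal supports, which turns a statement about distributions into one
  about every outcome of the coins.\<close>

lemma decides_halts: "decides M c t D \<Longrightarrow> c' \<in> set_pmf (run M t c) \<Longrightarrow> halted M c'"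
proof -
  assume "decides M c t D" and c': "c' \<in> set_pmf (run M t c)"
  then have "fst ` set_pmf (run M t c) = answer_state M ` set_pmf D"
    by (metis decides_def order_refl set_map_pmf)
  with c' show "halted M c'" by (force simp: halted_iff_answer)
qed

lemma decides_bind_run:
  assumes "run M m c = map_pmf f P" and "\<And>x. x \<in> set_pmf P \<Longrightarrow> decides M (f x) t (D x)"
  shows "decides M c (m + t) (bind_pmf P D)"
  unfolding decides_def
proof (intro allI impI)
  fix n assume n: "m + t \<le> n"
  then obtain n' where n': "n = m + n'" "t \<le> n'" by (metis add.assoc le_add1 le_iff_add)
  show "map_pmf fst (run M n c) = map_pmf (answer_state M) (bind_pmf P D)"
    using assms n'(2)
    by (auto simp: n'(1) run_add map_bind_pmf bind_map_pmf decides_def intro!: bind_pmf_cong)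
qed

lemma decides_step:
  assumes "\<not> halted M c" "\<And>r. next_config M c r = c'" "decides M c' t D"
  shows "decides M c (Suc t) D"
proof -
  have "run M 1 c = map_pmf (\<lambda>_. c') (return_pmf ())"
    using assms(1,2) by (simp add: run_Suc_const del: run.simps(2))
  from decides_bind_run[OF this, of t "\<lambda>_. D"] assms(3) show ?thesis
    by (simp add: bind_return_pmf)
qed

text \<open>\<open>M'\<close> mirrors \<open>M\<close> step by step on the same coins, spends one
  step on leaving the halted copy, and then runs the continuation selected by the answer. The
  induction follows actual configurations; only at the end is the run replaced by
  \<open>D\<close>.\<close>

lemma decides_simulation:
  assumes inv: "\<And>c r. I c \<Longrightarrow> \<not> halted M c \<Longrightarrow> I (next_config M c r)"
    and sim: "\<And>c r. I c \<Longrightarrow> \<not> halted M c \<Longrightarrow> next_config M' (emb c) r = emb (next_config M c r)"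
    and nhalt: "\<And>c. I c \<Longrightarrow> \<not> halted M' (emb c)"
    and leave: "\<And>c r. I c \<Longrightarrow> halted M c \<Longrightarrow> next_config M' (emb c) r = leave_to c"
    and rest: "\<And>c b. I c \<Longrightarrow> fst c = answer_state M b \<Longrightarrow> decides M' (leave_to c) t (F b)"
    and "I c" "decides M c k D" and neq: "yes_state M \<noteq> no_state M"
  shows "decides M' (emb c) (Suc (k + t)) (bind_pmf D F)"
proof -
  \<comment> \<open>Continuations are indexed by states here, because the hypothesis on
    \<open>D\<close> speaks of \<open>map_pmf fst\<close> of the run.\<close>
  define F' where "F' q = F (q = yes_state M)" for q
  have F': "F' (answer_state M b) = F b" for b
    using neq by (auto simp: F'_def answer_state_def)
  have fin: "decides M' (emb c) (Suc (k + t)) (F' (fst c))" if "I c" "halted M c" for c k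
  proof -
    from that(2) obtain b where b: "fst c = answer_state M b" by (auto simp: halted_iff_answer)
    have "decides M' (emb c) (Suc t) (F b)"
      using decides_step[OF nhalt leave rest] that b by blast
    then show ?thesis by (simp add: b F' decides_mono)
  qed
  have "decides M' (emb c) (Suc (k + t)) (bind_pmf (run M k c) (\<lambda>c'. F' (fst c')))"
    if "I c" "\<forall>c'\<in>set_pmf (run M k c). halted M c'" for c
    using that
  proof (induction k arbitrary: c)
    case 0
    then show ?case using fin[of c 0] by (simp add: bind_return_pmf)
  next
    case (Suc k)
    show ?case
    proof (cases "halted M c")
      case True
      then show ?thesis using fin[of c "Suc k"] Suc.prems
        by (simp add: run_halted bind_return_pmf del: run.simps)
    next
      case False
      have "decides M' (emb (next_config M c r)) (Suc (k + t))
              (bind_pmf (run M k (next_config M c r)) (\<lambda>c'. F' (fst c')))" for r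
      proof (rule Suc.IH)
        show "I (next_config M c r)" using inv Suc.prems False by blast
        show "\<forall>c'\<in>set_pmf (run M k (next_config M c r)). halted M c'"
          using Suc.prems(2) False by (cases r) (auto simp: run_Suc_coin simp del: run.simps)
      qed
      moreover have "run M' 1 (emb c) =
          map_pmf (\<lambda>r. emb (next_config M c r)) (bernoulli_pmf (1/2))"
        using sim nhalt Suc.prems(1) False unfolding One_nat_def
        by (subst run_Suc_coin) (auto simp: map_pmf_def)
      ultimately have "decides M' (emb c) (1 + Suc (k + t)) (bind_pmf (bernoulli_pmf (1/2))
           (\<lambda>r. bind_pmf (run M k (next_config M c r)) (\<lambda>c'. F' (fst c'))))"
        by (intro decides_bind_run)
      then show ?thesis using False by (simp add: run_Suc_coin bind_assoc_pmf del: run.simps)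
    qed
  qed
  then have "decides M' (emb c) (Suc (k + t)) (bind_pmf (run M k c) (\<lambda>c'. F' (fst c')))"
    using decides_halts assms(6,7) by blast
  also have "bind_pmf (run M k c) (\<lambda>c'. F' (fst c')) = bind_pmf (map_pmf fst (run M k c)) F'"
    by (simp add: bind_map_pmf)
  also have "\<dots> = bind_pmf D F"
    using assms(7) by (simp add: decides_def bind_map_pmf F')
  finally show ?thesis .
qed

section \<open>Hosting one machine inside another\<close>

definition valid_config :: "tm \<Rightarrow> config \<Rightarrow> bool" where
  "valid_config M c \<longleftrightarrow> fst c < num_states M \<and> length (snd c) = num_tapes M \<and>
     (\<forall>t\<in>set (snd c). \<forall>p. fst t p < num_symbols M)"

definition valid_action :: "tm \<Rightarrow> nat \<times> (nat \<times> move) list \<Rightarrow> bool" where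
  "valid_action M a \<longleftrightarrow> fst a < num_states M \<and> length (snd a) = num_tapes M \<and>
     fst ` set (snd a) \<subseteq> {..<num_symbols M}"

lemma valid_config_delta:
  assumes "wf_tm M" "valid_config M c"
  shows "valid_action M (delta M (fst c) (map read_tape (snd c)) r)"
proof -
  have "set (map read_tape (snd c)) \<subseteq> {..<num_symbols M}"
    using assms(2) by (auto simp: valid_config_def read_tape_def)
  then show ?thesis
    using assms unfolding wf_tm_def valid_action_def valid_config_def by simp
qed

text \<open>Since \<open>wf_tm\<close> restricts \<open>delta\<close> only on legal states and
  symbols, simulations carry this invariant. It covers all cells because the heads move.\<close>

lemma valid_config_next:
  assumes "wf_tm M" "valid_config M c"
  shows "valid_config M (next_config M c r)"
proof -
  obtain q as where d: "delta M (fst c) (map read_tape (snd c)) r = (q, as)" by fastforce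
  have "valid_action M (q, as)" using valid_config_delta[OF assms, of r] by (simp add: d)
  moreover have "fst (act_tape (fst x) (snd x)) p < num_symbols M"
    if "x \<in> set (zip (snd c) as)" "valid_action M (q, as)" for x p
  proof -
    from that(1) have "fst x \<in> set (snd c)" "snd x \<in> set as"
      by (metis in_set_zipE prod.collapse)+
    then show ?thesis using assms(2) that(2)
      by (auto simp: valid_action_def valid_config_def act_tape_def)
  qed
  ultimately show ?thesis using assms(2)
    by (auto simp: valid_config_def next_config_def d valid_action_def)
qed

definition idle :: "nat list \<Rightarrow> (nat \<times> move) list" where
  "idle ss = map (\<lambda>s. (s, Stay)) ss"

lemma length_idle [simp]: "length (idle ss) = length ss"
  by (simp add: idle_def)

lemma set_idle [simp]: "fst ` set (idle ss) = set ss"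
  by (force simp: idle_def)

lemma idle_simps [simp]: "idle [] = []" "idle (s # ss) = (s, Stay) # idle ss"
  by (simp_all add: idle_def)

lemma act_tape_idle [simp]: "act_tape t (read_tape t, Stay) = t"
  by (simp add: act_tape_def read_tape_def)

lemma act_idle [simp]: "map2 act_tape ts (idle (map read_tape ts)) = ts"
  by (induction ts) (simp_all add: idle_def)

text \<open>
  The transition function of a well-formed machine is arbitrary on symbols outside its alphabet.
  A machine that hosts another one over a larger alphabet has to repair such actions in order to be
  well-formed itself.
\<close>

definition checked_delta :: "tm \<Rightarrow> nat \<Rightarrow> nat list \<Rightarrow> bool \<Rightarrow> nat \<times> (nat \<times> move) list" where
  "checked_delta M q ss r =
     (if valid_action M (delta M q ss r) then delta M q ss r else (no_state M, idle ss))"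

text \<open>The symbols 2 and 1 code True and False entries, so a True coin deletes an edge, while
  row ends and absent edges never change.\<close>

definition mask_symbol :: "bool \<Rightarrow> bool \<Rightarrow> nat \<Rightarrow> nat" where
  "mask_symbol msk r a = (if msk \<and> r \<and> a = 2 then 1 else a)"

text \<open>A coin is tossed for every symbol, even where it has no effect, because the machine
  tosses one in every step.\<close>

primrec mask_word :: "bool \<Rightarrow> nat list \<Rightarrow> nat list pmf" where
  "mask_word msk [] = return_pmf []"
| "mask_word msk (a # w) = bind_pmf (bernoulli_pmf (1/2)) (\<lambda>r.
     map_pmf ((#) (mask_symbol msk r a)) (mask_word msk w))"

text \<open>
  Tape 0 of the machine \<open>chain msk b M1 M2\<close> holds the input \<open>w\<close>, followed by the tapes of \<open>M1\<close> and
  of \<open>M2\<close>. It writes the same \<open>u\<close> on both input tapes, where \<open>u = w\<close> or, if \<open>msk\<close> holds, \<open>u\<close> is a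
  random masking of \<open>w\<close>. It answers \<open>b\<close> if \<open>M1\<close> answers \<open>b\<close>, and otherwise it answers like \<open>M2\<close>; so
  \<open>b = False\<close> computes a conjunction and \<open>b = True\<close> a disjunction.

  States: 0 initial, 1 copying, 2 rewinding, 3 yes, 4 no, then the states of \<open>M1\<close>, then those of
  \<open>M2\<close>. The initial state rejects words that do not start with a matrix entry: a matrix without
  columns has size 0 but an arbitrarily long code, which there is no time to copy.
\<close>

definition chain_delta ::
  "bool \<Rightarrow> bool \<Rightarrow> tm \<Rightarrow> tm \<Rightarrow> nat \<Rightarrow> nat list \<Rightarrow> bool \<Rightarrow> nat \<times> (nat \<times> move) list" where
  "chain_delta msk b M1 M2 q ss r =
     (let s = hd ss; ss1 = take (num_tapes M1) (tl ss); ss2 = drop (num_tapes M1) (tl ss);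
          enter2 = 5 + num_states M1 + start_state M2;
          heads = (\<lambda>d a1 a2. (s, d) # ((a1, d) # idle (tl ss1)) @ ((a2, d) # idle (tl ss2)))
      in if q = 0 then (if s = 1 \<or> s = 2 then 1 else 4, idle ss)
         else if q = 1 then
           (if s = 0 then (2, heads Move_Left (hd ss1) (hd ss2))
            else (1, heads Move_Right (mask_symbol msk r s) (mask_symbol msk r s)))
         else if q = 2 then
           (if s = 0 then (5 + start_state M1, heads Move_Right (hd ss1) (hd ss2))
            else (2, heads Move_Left (hd ss1) (hd ss2)))
         else if q < 5 then (q, idle ss)
         else if q < 5 + num_states M1 then
           (if q - 5 = yes_state M1 then (if b then 3 else enter2, idle ss)
            else if q - 5 = no_state M1 then (if b then enter2 else 4, idle ss)
            else (case checked_delta M1 (q - 5) ss1 r of (q', as) \<Rightarrow>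
              (5 + q', (s, Stay) # as @ idle ss2)))
         else
           (if q - (5 + num_states M1) = yes_state M2 then (3, idle ss)
            else if q - (5 + num_states M1) = no_state M2 then (4, idle ss)
            else (case checked_delta M2 (q - (5 + num_states M1)) ss2 r of (q', as) \<Rightarrow>
              (5 + num_states M1 + q', (s, Stay) # idle ss1 @ as))))"

definition chain :: "bool \<Rightarrow> bool \<Rightarrow> tm \<Rightarrow> tm \<Rightarrow> tm" where
  "chain msk b M1 M2 =
     \<lparr> num_states = 5 + num_states M1 + num_states M2,
       num_tapes = 1 + num_tapes M1 + num_tapes M2,
       num_symbols = max (num_symbols M1) (num_symbols M2),
       start_state = 0, yes_state = 3, no_state = 4,
       delta = chain_delta msk b M1 M2 \<rparr>"

lemma chain_simps [simp]:
  "num_states (chain msk b M1 M2) = 5 + num_states M1 + num_states M2"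
  "num_tapes (chain msk b M1 M2) = 1 + num_tapes M1 + num_tapes M2"
  "num_symbols (chain msk b M1 M2) = max (num_symbols M1) (num_symbols M2)"
  "start_state (chain msk b M1 M2) = 0"
  "yes_state (chain msk b M1 M2) = 3"
  "no_state (chain msk b M1 M2) = 4"
  "delta (chain msk b M1 M2) = chain_delta msk b M1 M2"
  by (simp_all add: chain_def)

text \<open>The fallback action writes back the symbols read, which may lie outside the alphabet of
  \<open>M\<close>; hence the union with \<open>set ss\<close>.\<close>

lemma checked_delta_valid:
  assumes "wf_tm M" "length ss = num_tapes M"
  shows "fst (checked_delta M q ss r) < num_states M"
    "length (snd (checked_delta M q ss r)) = num_tapes M"
    "fst ` set (snd (checked_delta M q ss r)) \<subseteq> {..<num_symbols M} \<union> set ss"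
  using assms by (auto simp: checked_delta_def valid_action_def wf_tm_def)

lemma wf_chain:
  assumes "wf_tm M1" "wf_tm M2"
  shows "wf_tm (chain msk b M1 M2)"
proof -
  let ?M = "chain msk b M1 M2"
  have "valid_action ?M (delta ?M q ss r)"
    if q: "q < num_states ?M" and len: "length ss = num_tapes ?M"
      and sym: "set ss \<subseteq> {..<num_symbols ?M}" for q ss r
  proof -
    have k: "num_tapes M1 \<ge> 1" "num_tapes M2 \<ge> 1" using assms by (auto simp: wf_tm_def)
    obtain s ss' where ss: "ss = s # ss'" using len by (cases ss) auto
    obtain s1 r1 where 1: "take (num_tapes M1) ss' = s1 # r1"
      using len k ss by (cases "take (num_tapes M1) ss'") auto
    obtain s2 r2 where 2: "drop (num_tapes M1) ss' = s2 # r2"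
      using len k ss by (cases "drop (num_tapes M1) ss'") auto
    have ss'': "ss' = s1 # r1 @ s2 # r2"
      using 1 2 by (metis append_Cons append_take_drop_id)
    have l: "length (s1 # r1) = num_tapes M1" "length (s2 # r2) = num_tapes M2"
      using len 1 2 ss by (auto simp flip: 1 2)
    obtain q1 as1 where c1: "checked_delta M1 (q - 5) (s1 # r1) r = (q1, as1)" by fastforce
    obtain q2 as2 where c2: "checked_delta M2 (q - (5 + num_states M1)) (s2 # r2) r = (q2, as2)"
      by fastforce
    note v1 = checked_delta_valid[OF assms(1) l(1), of "q - 5" r, unfolded c1]
    note v2 = checked_delta_valid[OF assms(2) l(2), of "q - (5 + num_states M1)" r, unfolded c2]
    have st: "start_state M1 < num_states M1" "start_state M2 < num_states M2"
      "4 \<le> num_symbols M1" "4 \<le> num_symbols M2"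
      using assms by (auto simp: wf_tm_def)
    have m: "mask_symbol msk r s < max (num_symbols M1) (num_symbols M2)"
      "mask_symbol msk r (Suc 0) < max (num_symbols M1) (num_symbols M2)"
      "mask_symbol msk r 2 < max (num_symbols M1) (num_symbols M2)"
      using sym st by (auto simp: mask_symbol_def ss)
    have set1: "fst ` set as1 \<subseteq> {..<max (num_symbols M1) (num_symbols M2)}"
      using v1(3) sym by (fastforce simp: ss ss'')
    have set2: "fst ` set as2 \<subseteq> {..<max (num_symbols M1) (num_symbols M2)}"
      using v2(3) sym by (fastforce simp: ss ss'')
    show ?thesis
      using q len sym m st l v1(1,2) v2(1,2) set1 set2 c1 c2
      unfolding chain_simps chain_delta_def Let_def ss list.sel 1 2
      by (simp add: valid_action_def ss ss'' image_Un split del: if_split split: if_splits)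
  qed
  then show ?thesis
    using assms unfolding wf_tm_def valid_action_def by auto
qed

section \<open>Copying, masking and rewinding the input\<close>

definition tape_at :: "nat list \<Rightarrow> int \<Rightarrow> tape" where
  "tape_at u p = (fst (input_tape u), p)"

lemma input_tape_eq: "input_tape u = tape_at u 0"
  by (simp add: tape_at_def input_tape_def)

lemma read_tape_at: "read_tape (tape_at u p) = (if 0 \<le> p \<and> p < int (length u) then u ! nat p else 0)"
  by (simp add: read_tape_def tape_at_def input_tape_def)

lemma act_tape_keep [simp]:
  "act_tape (tape_at u p) (read_tape (tape_at u p), d) = tape_at u (p + shift d)"
  by (simp add: act_tape_def read_tape_def tape_at_def)

lemma act_tape_blank:
  "read_tape (tape_at u p) = 0 \<Longrightarrow> act_tape (tape_at u p) (0, d) = tape_at u (p + shift d)"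
  by (metis act_tape_keep)

lemma act_tape_append:
  "act_tape (tape_at u (int (length u))) (a, Move_Right) = tape_at (u @ [a]) (int (length u) + 1)"
  by (auto simp: act_tape_def tape_at_def input_tape_def fun_eq_iff nth_append nat_less_iff)

lemma map2_append:
  "length xs = length as \<Longrightarrow> map2 f (xs @ ys) (as @ bs) = map2 f xs as @ map2 f ys bs"
  by simp

context
  fixes msk b :: bool and M1 M2 :: tm
  assumes wf1: "wf_tm M1" and wf2: "wf_tm M2"
begin

private abbreviation (input) "M \<equiv> chain msk b M1 M2"

text \<open>The heads on the input and on both copies move in lockstep, so a single position
  \<open>p\<close> describes them, and rewinding the input rewinds the copies. It ranges from -1 to
  the length of \<open>w\<close>, one cell beyond either end.\<close>

definition copying :: "nat \<Rightarrow> nat list \<Rightarrow> nat list \<Rightarrow> int \<Rightarrow> config" where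
  "copying q w u p =
     (q, tape_at w p # (tape_at u p # replicate (num_tapes M1 - 1) (input_tape [])) @
           (tape_at u p # replicate (num_tapes M2 - 1) (input_tape [])))"

lemma num_tapes_pos: "num_tapes M1 = Suc (num_tapes M1 - 1)" "num_tapes M2 = Suc (num_tapes M2 - 1)"
  using wf1 wf2 by (auto simp: wf_tm_def)

lemma init_config_chain: "init_config M w = copying 0 w [] 0"
  using num_tapes_pos
  by (simp add: init_config_def copying_def input_tape_eq flip: replicate_Suc replicate_add)

lemma read_copying:
  assumes "ss = map read_tape (snd (copying q w u p))"
  shows "hd ss = read_tape (tape_at w p)"
    "take (num_tapes M1) (tl ss) =
      read_tape (tape_at u p) # map read_tape (replicate (num_tapes M1 - 1) (input_tape []))"
    "drop (num_tapes M1) (tl ss) =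
      read_tape (tape_at u p) # map read_tape (replicate (num_tapes M2 - 1) (input_tape []))"
proof -
  let ?B1 = "tape_at u p # replicate (num_tapes M1 - 1) (input_tape [])"
  let ?B2 = "tape_at u p # replicate (num_tapes M2 - 1) (input_tape [])"
  have *: "ss = read_tape (tape_at w p) # map read_tape ?B1 @ map read_tape ?B2"
    by (simp add: assms copying_def)
  have "length (map read_tape ?B1) = num_tapes M1"
    using num_tapes_pos(1) by simp
  then have "take (num_tapes M1) (tl ss) = map read_tape ?B1"
    "drop (num_tapes M1) (tl ss) = map read_tape ?B2"
    unfolding * by (simp_all del: list.map map_replicate)
  then show "hd ss = read_tape (tape_at w p)"
    "take (num_tapes M1) (tl ss) =
      read_tape (tape_at u p) # map read_tape (replicate (num_tapes M1 - 1) (input_tape []))"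
    "drop (num_tapes M1) (tl ss) =
      read_tape (tape_at u p) # map read_tape (replicate (num_tapes M2 - 1) (input_tape []))"
    by (simp_all add: *)
qed

lemma fst_copying [simp]: "fst (copying q w u p) = q"
  by (simp add: copying_def)

text \<open>Both copies receive the same symbol and all three heads the same move, so it suffices to
  check tape 0 and one copy.\<close>

lemma next_copying:
  assumes "chain_delta msk b M1 M2 q (map read_tape (snd (copying q w u p))) r =
     (q', (s, d) # ((a1, d) # idle (map read_tape (replicate (num_tapes M1 - 1) (input_tape [])))) @
                   ((a1, d) # idle (map read_tape (replicate (num_tapes M2 - 1) (input_tape [])))))"
    and "act_tape (tape_at w p) (s, d) = tape_at w p'"
    and "act_tape (tape_at u p) (a1, d) = tape_at u' p'"
  shows "next_config M (copying q w u p) r = copying q' w u' p'"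
  unfolding next_config_def chain_simps fst_copying assms(1) split_conv
  using assms(2,3) by (simp add: copying_def map2_append del: map_replicate)

lemma next_initial:
  assumes "read_tape (tape_at w p) \<in> {1, 2}"
  shows "next_config M (copying 0 w u p) r = copying 1 w u p"
  using assms unfolding next_config_def chain_simps fst_copying chain_delta_def Let_def
    read_copying[OF refl]
  by (auto simp: copying_def simp del: map_replicate list.map map_append)

lemma reject_initial:
  assumes "read_tape (tape_at w p) \<notin> {1, 2}"
  shows "fst (next_config M (copying 0 w u p) r) = answer_state M False"
  using assms unfolding next_config_def chain_simps fst_copying chain_delta_def Let_def
    read_copying[OF refl]
  by (auto simp: answer_state_def)

lemma next_copy:
  assumes "read_tape (tape_at w p) \<noteq> 0" "p = int (length u)"
  shows "next_config M (copying 1 w u p) r =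
           copying 1 w (u @ [mask_symbol msk r (read_tape (tape_at w p))]) (p + 1)"
  by (rule next_copying[where s = "read_tape (tape_at w p)" and d = Move_Right and
     ?a1.0 = "mask_symbol msk r (read_tape (tape_at w p))"])
    (use assms in \<open>simp_all add: chain_delta_def Let_def read_copying[OF refl]
      act_tape_append act_tape_blank del: list.map map_replicate\<close>)

lemma next_copy_end:
  assumes "read_tape (tape_at w p) = 0"
  shows "next_config M (copying 1 w u p) r = copying 2 w u (p - 1)"
  by (rule next_copying[where s = "read_tape (tape_at w p)" and d = Move_Left and
     ?a1.0 = "read_tape (tape_at u p)"])
    (use assms in \<open>simp_all add: chain_delta_def Let_def read_copying[OF refl]
      act_tape_blank del: list.map map_replicate\<close>)

lemma next_rewind:
  assumes "read_tape (tape_at w p) \<noteq> 0"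
  shows "next_config M (copying 2 w u p) r = copying 2 w u (p - 1)"
  by (rule next_copying[where s = "read_tape (tape_at w p)" and d = Move_Left and
     ?a1.0 = "read_tape (tape_at u p)"])
    (use assms in \<open>simp_all add: chain_delta_def Let_def read_copying[OF refl]
      act_tape_blank del: list.map map_replicate\<close>)

lemma next_rewind_end:
  assumes "read_tape (tape_at w p) = 0"
  shows "next_config M (copying 2 w u p) r = copying (5 + start_state M1) w u (p + 1)"
  by (rule next_copying[where s = "read_tape (tape_at w p)" and d = Move_Right and
     ?a1.0 = "read_tape (tape_at u p)"])
    (use assms in \<open>simp_all add: chain_delta_def Let_def read_copying[OF refl]
      act_tape_blank del: list.map map_replicate\<close>)

lemma not_halted_copying: "q < 3 \<Longrightarrow> \<not> halted M (copying q w u p)"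
  by (simp add: halted_def)

text \<open>Induction on the unread suffix, with the copied prefix generalized: each step consumes
  one coin and appends one symbol, exactly as in the recursion of \<open>mask_word\<close>.\<close>

lemma run_copy:
  assumes "0 \<notin> set suf" "length u = length pre"
  shows "run M (length suf) (copying 1 (pre @ suf) u (int (length pre))) =
     map_pmf (\<lambda>s. copying 1 (pre @ suf) (u @ s) (int (length (pre @ suf)))) (mask_word msk suf)"
  using assms
proof (induction suf arbitrary: pre u)
  case Nil
  then show ?case by simp
next
  case (Cons a suf)
  have read: "read_tape (tape_at (pre @ a # suf) (int (length pre))) = a"
    by (simp add: read_tape_at nth_append)
  have "run M (length suf) (copying 1 (pre @ a # suf) (u @ [mask_symbol msk r a])
       (int (length pre) + 1)) =
     map_pmf (\<lambda>s. copying 1 (pre @ a # suf) (u @ mask_symbol msk r a # s)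
       (int (length (pre @ a # suf))))
       (mask_word msk suf)" for r
    using Cons.IH[of "u @ [mask_symbol msk r a]" "pre @ [a]"] Cons.prems by (simp add: add.commute)
  moreover have "next_config M (copying 1 (pre @ a # suf) u (int (length pre))) r =
      copying 1 (pre @ a # suf) (u @ [mask_symbol msk r a]) (int (length pre) + 1)" for r
    by (rule next_copy[of "pre @ a # suf" "int (length pre)" u r, unfolded read])
      (use Cons.prems in auto)
  moreover have "\<not> halted M (copying 1 (pre @ a # suf) u (int (length pre)))"
    by (rule not_halted_copying) simp
  ultimately show ?case
    unfolding list.size add_Suc_right add_0_right
    by (subst run_Suc_coin) (simp_all add: map_bind_pmf map_pmf_comp)
qed

text \<open>Besides the \<open>j\<close> symbols to the left there is the blank at -1, whose step
  moves the heads back to 0; hence \<open>Suc j\<close> steps.\<close>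

lemma run_rewind:
  assumes "0 \<notin> set w" "j \<le> length w"
  shows "run M (Suc j) (copying 2 w u (int j - 1)) = return_pmf (copying (5 + start_state M1) w u 0)"
  using assms
proof (induction j)
  case 0
  have "read_tape (tape_at w (-1)) = 0" by (simp add: read_tape_at)
  from next_rewind_end[OF this, of u] show ?case
    using run_Suc_const[of M "copying 2 w u (-1)" "copying (5 + start_state M1) w u 0" 0]
    by (simp add: not_halted_copying del: run.simps(2))
next
  case (Suc j)
  have "read_tape (tape_at w (int j)) \<noteq> 0"
  proof -
    have "w ! j \<in> set w" using Suc.prems by auto
    then have "w ! j \<noteq> 0" using Suc.prems by metis
    then show ?thesis using Suc.prems by (simp add: read_tape_at)
  qed
  from next_rewind[OF this, of u] show ?case
    using run_Suc_const[of M "copying 2 w u (int j)" "copying 2 w u (int j - 1)" "Suc j"] Suc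
    by (simp add: not_halted_copying del: run.simps(2))
qed

section \<open>Running the two hosted machines in sequence\<close>

definition embed1 :: "tape \<Rightarrow> tape list \<Rightarrow> config \<Rightarrow> config" where
  "embed1 t ts2 c = (5 + fst c, t # snd c @ ts2)"

definition embed2 :: "tape \<Rightarrow> tape list \<Rightarrow> config \<Rightarrow> config" where
  "embed2 t ts1 c = (5 + num_states M1 + fst c, t # ts1 @ snd c)"

lemma copying_embed1:
  "copying (5 + start_state M1) w u 0 =
   embed1 (input_tape w) (snd (init_config M2 u)) (init_config M1 u)"
  by (simp add: copying_def embed1_def init_config_def input_tape_eq)

text \<open>One step leaves the initial state, \<open>length w\<close> steps copy, one step turns
  round at the blank, and \<open>length w + 1\<close> steps rewind.\<close>

lemma run_prepare:
  assumes "w = a # v" "a = 1 \<or> a = 2" "0 \<notin> set v"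
  shows "run M (2 * length w + 3) (init_config M w) =
     map_pmf (\<lambda>u. embed1 (input_tape w) (snd (init_config M2 u)) (init_config M1 u)) (mask_word msk w)"
proof -
  have w0: "0 \<notin> set w" using assms by auto
  have "run M 1 (init_config M w) = return_pmf (copying 1 w [] 0)"
    unfolding One_nat_def init_config_chain
    by (subst run_Suc_const[where c' = "copying 1 w [] 0"])
      (use assms in \<open>auto simp: not_halted_copying next_initial read_tape_at\<close>)
  moreover have "run M (length w) (copying 1 w [] 0) =
      map_pmf (\<lambda>u. copying 1 w u (int (length w))) (mask_word msk w)"
    using run_copy[of w "[]" "[]"] w0 by simp
  moreover have "run M 1 (copying 1 w u (int (length w))) =
      return_pmf (copying 2 w u (int (length w) - 1))" for u
    unfolding One_nat_def
    by (subst run_Suc_const[where c' = "copying 2 w u (int (length w) - 1)"])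
      (simp_all add: not_halted_copying[of 1, simplified]
        next_copy_end[unfolded One_nat_def] read_tape_at)
  moreover have "run M (Suc (length w)) (copying 2 w u (int (length w) - 1)) =
      return_pmf (copying (5 + start_state M1) w u 0)" for u
    using run_rewind w0 by blast
  moreover have "2 * length w + 3 = 1 + (length w + (1 + Suc (length w)))" by simp
  ultimately show ?thesis
    by (simp only: run_add bind_return_pmf bind_assoc_pmf copying_embed1 map_pmf_def)
qed

text \<open>A simulation with trivial continuation: the leaving step already enters the answer
  state, so \<open>t = 0\<close>.\<close>

lemma decides_phase2:
  assumes "valid_config M2 c" "decides M2 c k D" "length ts1 = num_tapes M1"
  shows "decides M (embed2 t ts1 c) (Suc k) D"
proof -
  have read: "take (num_tapes M1) (tl (map read_tape (t # ts1 @ ts))) = map read_tape ts1"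
    "drop (num_tapes M1) (tl (map read_tape (t # ts1 @ ts))) = map read_tape ts" for ts
    using assms(3) by auto
  have neq: "yes_state M2 \<noteq> no_state M2" using wf2 by (simp add: wf_tm_def)
  have "decides M (embed2 t ts1 c) (Suc (k + 0)) (bind_pmf D return_pmf)"
  proof (rule decides_simulation[where I = "valid_config M2" and M = M2 and
        emb = "embed2 t ts1" and F = return_pmf and t = 0 and
        leave_to = "\<lambda>c. (if fst c = yes_state M2 then 3 else 4, t # ts1 @ snd c)"])
    show "valid_config M2 c \<Longrightarrow> valid_config M2 (next_config M2 c r)" for c r
      using valid_config_next wf2 by blast
    show "next_config M (embed2 t ts1 c) r = embed2 t ts1 (next_config M2 c r)"
      if c: "valid_config M2 c" and "\<not> halted M2 c" for c r
    proof -
      obtain q' as where d: "delta M2 (fst c) (map read_tape (snd c)) r = (q', as)" by fastforce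
      have "checked_delta M2 (fst c) (map read_tape (snd c)) r = (q', as)"
        using valid_config_delta[OF wf2 c, of r] by (simp add: checked_delta_def d)
      then show ?thesis
        using that assms(3) unfolding next_config_def chain_simps chain_delta_def Let_def embed2_def
          snd_conv fst_conv read
        by (simp add: halted_def d map2_append)
    qed
    show "\<not> halted M (embed2 t ts1 c)" for c by (simp add: embed2_def halted_def)
    show "next_config M (embed2 t ts1 c) r = (if fst c = yes_state M2 then 3 else 4, t # ts1 @ snd c)"
      if "valid_config M2 c" and "halted M2 c" for c r
      using that neq unfolding next_config_def chain_simps chain_delta_def Let_def embed2_def
          snd_conv fst_conv read
      by (auto simp add: halted_def simp del: list.map map_append)
    show "decides M (if fst c = yes_state M2 then 3 else 4, t # ts1 @ snd c) 0 (return_pmf b)"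
      if "valid_config M2 c" "fst c = answer_state M2 b" for c b
      using that neq by (intro decides_answer) (auto simp: answer_state_def)
  qed (use assms neq in auto)
  then show ?thesis by (simp add: bind_return_pmf')
qed

text \<open>The input of \<open>M2\<close> was prepared during copying and stays untouched while
  \<open>M1\<close> runs, so leaving \<open>M1\<close> can enter the start state of
  \<open>M2\<close> directly. The summand 2 pays for one leaving step per machine.\<close>

lemma decides_phase1:
  assumes "valid_config M1 c" "decides M1 c k1 D1"
    and "valid_config M2 (init_config M2 u)" "decides M2 (init_config M2 u) k2 D2"
  shows "decides M (embed1 t (snd (init_config M2 u)) c) (k1 + k2 + 2)
     (bind_pmf D1 (\<lambda>x. if x = b then return_pmf b else D2))"
proof -
  define ts2 where "ts2 = snd (init_config M2 u)"
  \<comment> \<open>On a halted \<open>c\<close> the equivalence says that the answer of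
    \<open>M1\<close> is \<open>b\<close>, which is then final.\<close>
  define leave_to where "leave_to c =
    (if fst c = yes_state M1 \<longleftrightarrow> b then (if b then 3 else 4, t # snd c @ ts2)
     else embed2 t (snd c) (init_config M2 u))" for c :: config
  have read: "take (num_tapes M1) (tl (map read_tape (t # snd c @ ts2))) = map read_tape (snd c)"
    "drop (num_tapes M1) (tl (map read_tape (t # snd c @ ts2))) = map read_tape ts2"
    if "valid_config M1 c" for c
    using that by (auto simp: valid_config_def)
  have neq: "yes_state M1 \<noteq> no_state M1" using wf1 by (simp add: wf_tm_def)
  have "decides M (embed1 t ts2 c) (Suc (k1 + Suc k2))
     (bind_pmf D1 (\<lambda>x. if x = b then return_pmf b else D2))"
  proof (rule decides_simulation[where I = "valid_config M1" and M = M1 and leave_to = leave_to and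
        emb = "embed1 t ts2" and F = "\<lambda>x. if x = b then return_pmf b else D2" and t = "Suc k2"])
    show "valid_config M1 c \<Longrightarrow> valid_config M1 (next_config M1 c r)" for c r
      using valid_config_next wf1 by blast
    show "next_config M (embed1 t ts2 c) r = embed1 t ts2 (next_config M1 c r)"
      if c: "valid_config M1 c" and nh: "\<not> halted M1 c" for c r
    proof -
      obtain q' as where d: "delta M1 (fst c) (map read_tape (snd c)) r = (q', as)" by fastforce
      have "checked_delta M1 (fst c) (map read_tape (snd c)) r = (q', as)"
        "length as = length (snd c)"
        using valid_config_delta[OF wf1 c, of r] c
        by (simp_all add: checked_delta_def d valid_action_def valid_config_def)
      then show ?thesis
        using c nh unfolding next_config_def chain_simps chain_delta_def Let_def embed1_def
          snd_conv fst_conv read[OF c]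
        by (simp add: halted_def d map2_append valid_config_def)
    qed
    show "\<not> halted M (embed1 t ts2 c)" for c by (simp add: embed1_def halted_def)
    show "next_config M (embed1 t ts2 c) r = leave_to c"
      if c: "valid_config M1 c" and h: "halted M1 c" for c r
    proof -
      have "fst c < num_states M1" using c by (simp add: valid_config_def)
      then show ?thesis
        using h neq unfolding next_config_def chain_simps chain_delta_def Let_def embed1_def
          snd_conv fst_conv read[OF c]
        by (auto simp add: halted_def leave_to_def embed2_def ts2_def init_config_def
              simp del: list.map map_append)
    qed
    show "decides M (leave_to c) (Suc k2) (if x = b then return_pmf b else D2)"
      if "valid_config M1 c" "fst c = answer_state M1 x" for c x
    proof (cases "x = b")
      case True
      then show ?thesis using that neq
        by (auto intro!: decides_answer simp: leave_to_def answer_state_def)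
    next
      case False
      then have "leave_to c = embed2 t (snd c) (init_config M2 u)"
        using that neq by (auto simp: leave_to_def answer_state_def)
      then show ?thesis using decides_phase2[OF assms(3,4)] that(1) False
        by (simp add: valid_config_def)
    qed
  qed (use assms neq in auto)
  then show ?thesis by (simp add: ts2_def)
qed

lemma valid_init_config:
  assumes "wf_tm N" "set w \<subseteq> {1, 2, 3}"
  shows "valid_config N (init_config N w)"
proof -
  have "fst (input_tape v) p < num_symbols N" if "set v \<subseteq> {1, 2, 3}" for v p
  proof (cases "0 \<le> p \<and> p < int (length v)")
    case True
    then have "v ! nat p \<in> set v" by auto
    with that have "v ! nat p < 4" by auto
    with True assms(1) show ?thesis by (auto simp: input_tape_def wf_tm_def)
  qed (use assms(1) in \<open>auto simp: input_tape_def wf_tm_def\<close>)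
  from this[OF assms(2)] this[of "[]"] show ?thesis
    using assms(1) by (auto simp: valid_config_def init_config_def wf_tm_def)
qed

lemma set_mask_word:
  "u \<in> set_pmf (mask_word msk w) \<Longrightarrow> set w \<subseteq> {1, 2, 3} \<Longrightarrow> set u \<subseteq> {1, 2, 3}"
  by (induction w arbitrary: u) (fastforce simp: mask_symbol_def split: if_splits)+

text \<open>The word \<open>u\<close> is drawn once and read by both machines, so their answers are
  independent only given \<open>u\<close>.\<close>

lemma decides_chain:
  assumes "w = a # v" "a = 1 \<or> a = 2" "set w \<subseteq> {1, 2, 3}"
    and "\<And>u. u \<in> set_pmf (mask_word msk w) \<Longrightarrow> decides M1 (init_config M1 u) k1 (D1 u)"
    and "\<And>u. u \<in> set_pmf (mask_word msk w) \<Longrightarrow> decides M2 (init_config M2 u) k2 (D2 u)"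
  shows "decides M (init_config M w) (2 * length w + 3 + (k1 + k2 + 2))
     (bind_pmf (mask_word msk w) (\<lambda>u. bind_pmf (D1 u) (\<lambda>x. if x = b then return_pmf b else D2 u)))"
proof (rule decides_bind_run)
  show "run M (2 * length w + 3) (init_config M w) =
     map_pmf (\<lambda>u. embed1 (input_tape w) (snd (init_config M2 u)) (init_config M1 u)) (mask_word msk w)"
    using assms by (intro run_prepare) auto
next
  fix u assume u: "u \<in> set_pmf (mask_word msk w)"
  then have "set u \<subseteq> {1, 2, 3}" using set_mask_word assms(3) by blast
  with u show "decides M (embed1 (input_tape w) (snd (init_config M2 u)) (init_config M1 u))
      (k1 + k2 + 2) (bind_pmf (D1 u) (\<lambda>x. if x = b then return_pmf b else D2 u))"
    using assms(4,5) valid_init_config wf1 wf2 by (intro decides_phase1) auto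
qed

text \<open>This handles matrices without rows or columns, whose first cell is blank or a row
  end.\<close>

lemma decides_chain_reject:
  assumes "w = [] \<or> hd w = 3"
  shows "decides M (init_config M w) 1 (return_pmf False)"
proof -
  have "read_tape (tape_at w 0) \<notin> {1, 2}"
    using assms by (auto simp: read_tape_at hd_conv_nth)
  then have rej: "fst (next_config M (init_config M w) r) = answer_state M False" for r
    using reject_initial by (simp add: init_config_chain)
  have "\<not> halted M (init_config M w)"
    using not_halted_copying[of 0] by (simp add: init_config_chain)
  then have "run M 1 (init_config M w) =
      map_pmf (\<lambda>r. next_config M (init_config M w) r) (bernoulli_pmf (1/2))"
    unfolding One_nat_def by (subst run_Suc_coin) (auto simp: map_pmf_def)
  from decides_bind_run[OF this decides_answer[OF rej], of 0]
  show ?thesis by simp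
qed

end

section \<open>VC dimension and Littlestone's dimension of masked matrices\<close>

lemma mistakes_snoc:
  "mistakes L (h @ [(x, y)]) = mistakes L h + (if L h x \<noteq> y then 1 else 0)"
proof -
  have "{i. i < length (h @ [(x, y)]) \<and>
          L (take i (h @ [(x, y)])) (fst ((h @ [(x, y)]) ! i)) \<noteq> snd ((h @ [(x, y)]) ! i)} =
        {i. i < length h \<and> L (take i h) (fst (h ! i)) \<noteq> snd (h ! i)} \<union>
        (if L h x \<noteq> y then {length h} else {})"
    by (auto simp: nth_append less_Suc_eq)
  then show ?thesis
    unfolding mistakes_def by (auto simp: card_insert_if)
qed

definition version_space :: "('a \<Rightarrow> bool) set \<Rightarrow> ('a \<times> bool) list \<Rightarrow> ('a \<Rightarrow> bool) set" where
  "version_space C h = {c \<in> C. \<forall>(x, y)\<in>set h. c x = y}"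

definition positives :: "('a \<times> bool) list \<Rightarrow> 'a set" where
  "positives h = {x. (x, True) \<in> set h}"

definition cautious_halving :: "('a \<Rightarrow> bool) set \<Rightarrow> nat \<Rightarrow> 'a learner" where
  "cautious_halving C d h x \<longleftrightarrow> d \<le> card (positives h) \<and>
     card {c \<in> version_space C h. \<not> c x} \<le> card {c \<in> version_space C h. c x}"

lemma finite_positives [simp]: "finite (positives h)"
proof (rule finite_subset)
  show "positives h \<subseteq> fst ` set h" by (force simp: positives_def)
qed simp

text \<open>In the first phase the mistakes are exactly the True labels. At the switch there are
  \<open>d\<close> mistakes and fewer than \<open>2 ^ d\<close> consistent concepts, so the product
  is below \<open>2 ^ (2 * d)\<close>; afterwards every mistake at least halves the version space
  and the product cannot grow.\<close>

lemma mistakes_cautious_halving: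
  assumes C: "finite C" and d: "d > 0"
    and small: "\<And>S. S \<subseteq> X \<Longrightarrow> finite S \<Longrightarrow> card S = d \<Longrightarrow> card {c \<in> C. \<forall>x\<in>S. c x} < 2 ^ d"
    and "distinct (map fst h)" "fst ` set h \<subseteq> X"
  shows "if card (positives h) < d then mistakes (cautious_halving C d) h = card (positives h)
         else card (version_space C h) * 2 ^ mistakes (cautious_halving C d) h < 2 ^ (2 * d)"
  using assms(4,5)
proof (induction h rule: rev_induct)
  case Nil
  then show ?case using d by (simp add: positives_def mistakes_def)
next
  case (snoc xy h)
  obtain x y where xy: "xy = (x, y)" by fastforce
  let ?h = "h @ [(x, y)]" and ?L = "cautious_halving C d"
  have fin: "finite (version_space C h)" for h using C by (simp add: version_space_def)
  \<comment> \<open>Samples are distinct, so each True label contributes a new point.\<close>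
  have new: "x \<notin> positives h" using snoc.prems(1) by (force simp: positives_def xy)
  have pos: "positives ?h = (if y then insert x (positives h) else positives h)"
    by (auto simp: positives_def)
  have V: "version_space C ?h = {c \<in> version_space C h. c x = y}"
    by (auto simp: version_space_def)
  have IH: "if card (positives h) < d then mistakes ?L h = card (positives h)
         else card (version_space C h) * 2 ^ mistakes ?L h < 2 ^ (2 * d)"
    using snoc by simp
  show ?case
  proof (cases "card (positives h) < d")
    case True
    then have L: "\<not> ?L h x" by (simp add: cautious_halving_def)
    have m: "mistakes ?L ?h = card (positives ?h)"
      using True IH L new by (simp add: mistakes_snoc pos)
    show ?thesis
    proof (cases "card (positives ?h) < d")
      case True
      with m show ?thesis by (simp add: xy)
    next
      case False
      \<comment> \<open>One label adds at most one point, so the switch happens at exactly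
        \<open>d\<close> points, where \<open>small\<close> applies.\<close>
      then have card: "card (positives ?h) = d" using True new by (auto simp: pos split: if_splits)
      have "positives ?h \<subseteq> X" using snoc.prems(2) by (force simp: positives_def xy)
      then have "card {c \<in> C. \<forall>x\<in>positives ?h. c x} < 2 ^ d" using small card by simp
      moreover have "card (version_space C ?h) \<le> card {c \<in> C. \<forall>x\<in>positives ?h. c x}"
        using C by (intro card_mono) (auto simp: version_space_def positives_def)
      ultimately have "card (version_space C ?h) < 2 ^ d" by simp
      then show ?thesis using card m by (simp add: xy mult_2 power_add)
    qed
  next
    case False
    then have IH': "card (version_space C h) * 2 ^ mistakes ?L h < 2 ^ (2 * d)" using IH by simp
    have pos': "\<not> card (positives ?h) < d" using False new by (simp add: pos)
    \<comment> \<open>A mistake leaves only the side that lost the vote, or one side of a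
      tie.\<close>
    have "card (version_space C h) =
        card {c \<in> version_space C h. c x} + card {c \<in> version_space C h. \<not> c x}"
      by (subst card_Un_disjoint[symmetric]) (auto simp: fin intro!: arg_cong[of _ _ card])
    then have "card (version_space C ?h) * 2 ^ (if ?L h x \<noteq> y then 1 else 0)
        \<le> card (version_space C h)"
      using False unfolding V by (cases y) (simp_all add: cautious_halving_def)
    then have "card (version_space C ?h) * 2 ^ mistakes ?L ?h
        \<le> card (version_space C h) * 2 ^ mistakes ?L h"
      using mult_le_mono1[of _ "card (version_space C h)" "2 ^ mistakes ?L h"]
      by (simp add: mistakes_snoc power_add mult_ac split: if_splits)
    then show ?thesis using IH' pos' by (simp add: xy)
  qed
qed

lemma Ldim_less:
  assumes "finite C" "d > 0"
    and "\<And>S. S \<subseteq> X \<Longrightarrow> finite S \<Longrightarrow> card S = d \<Longrightarrow> card {c \<in> C. \<forall>x\<in>S. c x} < 2 ^ d"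
  shows "Ldim X C < 2 * d"
proof -
  let ?L = "cautious_halving C d"
  have "mistakes ?L h \<le> 2 * d - 1" if h: "h \<in> realizable_seqs X C" for h
  proof -
    \<comment> \<open>The concept realizing the sequence always survives, so the product bounds
      \<open>2 ^ mistakes\<close> itself.\<close>
    from h obtain c where c: "c \<in> version_space C h"
      by (force simp: realizable_seqs_def version_space_def)
    then have "card (version_space C h) \<ge> 1"
      using assms(1) by (auto simp: version_space_def Suc_le_eq card_gt_0_iff)
    then have *: "2 ^ mistakes ?L h \<le> card (version_space C h) * 2 ^ mistakes ?L h" by simp
    have "if card (positives h) < d then mistakes ?L h = card (positives h)
         else card (version_space C h) * 2 ^ mistakes ?L h < 2 ^ (2 * d)"
      using mistakes_cautious_halving[OF assms] h by (auto simp: realizable_seqs_def)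
    then have "mistakes ?L h < d \<or> (2::nat) ^ mistakes ?L h < 2 ^ (2 * d)"
      using * by (cases "card (positives h) < d") (auto simp only: if_True if_False dest: le_less_trans)
    then have "mistakes ?L h < d \<or> mistakes ?L h < 2 * d" by simp
    then show ?thesis by linarith
  qed
  \<comment> \<open>Without realizable sequences the supremum is that of the empty set, which is
    0.\<close>
  then have "mistake_bound X C ?L \<le> 2 * d - 1"
    unfolding mistake_bound_def
    by (cases "realizable_seqs X C = {}") (auto intro!: cSUP_least)
  moreover have "Ldim X C \<le> mistake_bound X C ?L"
    unfolding Ldim_def by (intro cINF_lower) auto
  ultimately show ?thesis using assms(2) by linarith
qed

section \<open>Masked matrices\<close>

definition mask_mat :: "bool mat \<Rightarrow> (nat \<times> nat \<Rightarrow> bool) \<Rightarrow> bool mat" where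
  "mask_mat G f = mat (dim_row G) (dim_col G) (\<lambda>x. G $$ x \<and> \<not> f x)"

lemma dim_mask_mat [simp]:
  "dim_row (mask_mat G f) = dim_row G" "dim_col (mask_mat G f) = dim_col G"
  "inst_size (mask_mat G f) = inst_size G" "points (mask_mat G f) = points G"
  by (simp_all add: mask_mat_def inst_size_def points_def)

lemma finite_concepts: "finite (concepts G)"
  by (simp add: concepts_def)

text \<open>Masking only deletes edges, so columns that are True on all of \<open>S\<close> after
  masking were so before. Counting columns instead of concepts is safe, since every concept comes
  from some column.\<close>

lemma Ldim_mask_mat_less:
  assumes "\<not> contains_biclique {..<dim_row G} {..<dim_col G} (edges G) d (2 ^ d)" "d > 0"
  shows "Ldim (points (mask_mat G f)) (concepts (mask_mat G f)) < 2 * d"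
proof (rule Ldim_less[OF finite_concepts assms(2)])
  let ?H = "mask_mat G f"
  fix S assume S: "S \<subseteq> points ?H" "finite S" "card S = d"
  define J where "J = {j. j < dim_col G \<and> (\<forall>i\<in>S. ?H $$ (i, j))}"
  have "{c \<in> concepts ?H. \<forall>x\<in>S. c x} \<subseteq> (\<lambda>j. \<lambda>i\<in>points ?H. ?H $$ (i, j)) ` J"
  proof safe
    fix c assume c: "c \<in> concepts ?H" "\<forall>x\<in>S. c x"
    then obtain j where j: "j < dim_col G" "c = (\<lambda>i\<in>points ?H. ?H $$ (i, j))"
      by (auto simp: concepts_def)
    with c(2) S(1) have "j \<in> J" by (force simp: J_def)
    with j(2) show "c \<in> (\<lambda>j. \<lambda>i\<in>points ?H. ?H $$ (i, j)) ` J" by blast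
  qed
  moreover have "finite J" by (simp add: J_def)
  ultimately have "card {c \<in> concepts ?H. \<forall>x\<in>S. c x} \<le> card J"
    by (meson card_image_le card_mono finite_imageI le_trans)
  moreover have "card J < 2 ^ d"
  proof (rule ccontr)
    assume "\<not> card J < 2 ^ d"
    then obtain T where T: "T \<subseteq> J" "card T = 2 ^ d" "finite T"
      using obtain_subset_with_card_n by (metis linorder_not_less)
    have "contains_biclique {..<dim_row G} {..<dim_col G} (edges G) d (2 ^ d)"
      unfolding contains_biclique_def
      by (rule exI[of _ S], rule conjI[rotated], rule exI[of _ T])
        (use S T in \<open>auto simp: J_def edges_def points_def mask_mat_def subset_iff\<close>)
    with assms(1) show False ..
  qed
  ultimately show "card {c \<in> concepts ?H. \<forall>x\<in>S. c x} < 2 ^ d" by simp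
qed

lemma card_le_VC:
  assumes "S \<subseteq> points G" "shatters (concepts G) S"
  shows "card S \<le> VC (points G) (concepts G)"
  unfolding VC_def
proof (rule cSUP_upper)
  show "S \<in> {S. S \<subseteq> points G \<and> finite S \<and> shatters (concepts G) S}"
    using assms finite_subset[of S "points G"] by (auto simp: points_def)
  have "card S \<le> card (points G)" if "S \<subseteq> points G" for S
    using that by (intro card_mono) (auto simp: points_def)
  then show "bdd_above (card ` {S. S \<subseteq> points G \<and> finite S \<and> shatters (concepts G) S})"
    by (intro bdd_aboveI[of _ "card (points G)"]) auto
qed

lemma card_le_VC_mask_mat:
  assumes "S \<subseteq> {..<dim_row G}" "T \<subseteq> {..<dim_col G}" "\<forall>i\<in>S. \<forall>j\<in>T. (i, j) \<in> edges G"
    and "\<And>Q. Q \<subseteq> S \<Longrightarrow> \<exists>j\<in>T. \<forall>i\<in>S. f (i, j) = (i \<in> Q)"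
  shows "card S \<le> VC (points (mask_mat G f)) (concepts (mask_mat G f))"
proof (rule card_le_VC)
  show "S \<subseteq> points (mask_mat G f)" using assms(1) by (simp add: points_def)
  show "shatters (concepts (mask_mat G f)) S"
    unfolding shatters_def
  proof
    fix p :: "nat \<Rightarrow> bool" assume p: "p \<in> S \<rightarrow>\<^sub>E UNIV"
    \<comment> \<open>A True mask bit deletes the edge, so the pattern \<open>p\<close> calls for
      deletion exactly where \<open>p\<close> is False.\<close>
    obtain j where j: "j \<in> T" "\<And>i. i \<in> S \<Longrightarrow> f (i, j) = (i \<in> {i\<in>S. \<not> p i})"
      using assms(4)[of "{i\<in>S. \<not> p i}"] by blast
    define c where "c = (\<lambda>i\<in>points G. mask_mat G f $$ (i, j))"
    have "restrict c S i = p i" for i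
    proof (cases "i \<in> S")
      case True
      then have "i < dim_row G" "j < dim_col G" "G $$ (i, j)"
        using assms(1-3) j(1) by (auto simp: edges_def)
      then show ?thesis using True j(2) by (simp add: c_def points_def mask_mat_def)
    next
      case False
      then show ?thesis using PiE_arb[OF p] by simp
    qed
    then have "restrict c S = p" by blast
    moreover have "c \<in> concepts (mask_mat G f)"
      using j(1) assms(2) by (auto simp: c_def concepts_def)
    ultimately show "p \<in> (\<lambda>c. restrict c S) ` concepts (mask_mat G f)" by blast
  qed
qed

section \<open>Random masks\<close>

abbreviation "coin \<equiv> bernoulli_pmf (1 / 2)"

text \<open>Mapping to the truth values of membership reduces the product rule for events to that
  for single points.\<close>

lemma prob_pair_Times:
  "measure_pmf.prob (pair_pmf P Q) (A \<times> B) = measure_pmf.prob P A * measure_pmf.prob Q B"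
proof -
  have prob: "measure_pmf.prob R X = pmf (map_pmf (\<lambda>x. x \<in> X) R) True" for R :: "'c pmf" and X
    by (simp add: pmf_map vimage_def)
  have "measure_pmf.prob (pair_pmf P Q) (A \<times> B) =
      pmf (map_pmf (\<lambda>(x, y). (x \<in> A, y \<in> B)) (pair_pmf P Q)) (True, True)"
    by (auto simp: pmf_map vimage_def intro!: arg_cong[of _ _ "measure_pmf.prob _"])
  then show ?thesis by (simp add: map_pair pmf_pair prob)
qed

lemma prob_Pi_coin_block:
  assumes "finite S"
  shows "measure_pmf.prob (Pi_pmf (S \<times> {j}) False (\<lambda>_. coin)) {f. \<exists>i\<in>S. f (i, j) \<noteq> q i} =
    1 - (1 / 2) ^ card S"
proof -
  let ?P = "Pi_pmf (S \<times> {j}) False (\<lambda>_. coin)"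
  have "{f. \<exists>i\<in>S. f (i, j) \<noteq> q i} = UNIV - Pi (S \<times> {j}) (\<lambda>x. {q (fst x)})"
    by (simp add: set_eq_iff Pi_iff)
  then have "measure_pmf.prob ?P {f. \<exists>i\<in>S. f (i, j) \<noteq> q i} =
      1 - measure_pmf.prob ?P (Pi (S \<times> {j}) (\<lambda>x. {q (fst x)}))"
    using measure_pmf.prob_compl[of "Pi (S \<times> {j}) (\<lambda>x. {q (fst x)})" ?P] by simp
  also have "measure_pmf.prob ?P (Pi (S \<times> {j}) (\<lambda>x. {q (fst x)})) =
      (\<Prod>x\<in>S \<times> {j}. measure_pmf.prob coin {q (fst x)})"
    using assms by (intro measure_Pi_pmf_Pi) auto
  also have "\<dots> = (\<Prod>x\<in>S \<times> {j}. 1 / 2)"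
  proof (intro prod.cong refl)
    show "measure_pmf.prob coin {c} = 1 / 2" for c
      by (cases c) (simp_all add: measure_pmf_single)
  qed
  finally show ?thesis by (simp add: card_cartesian_product power_divide)
qed

text \<open>Coins outside \<open>S \<times> T\<close> are marginalized away; the columns of
  \<open>T\<close> are then split off one by one as independent blocks.\<close>

lemma prob_Pi_coin_avoid:
  assumes "finite A" "finite S" "finite T" "S \<times> T \<subseteq> A"
  shows "measure_pmf.prob (Pi_pmf A False (\<lambda>_. coin)) {f. \<forall>j\<in>T. \<exists>i\<in>S. f (i, j) \<noteq> q i} =
    (1 - (1 / 2) ^ card S) ^ card T"
proof -
  let ?E = "\<lambda>T. {f. \<forall>j\<in>T. \<exists>i\<in>S. f (i, j) \<noteq> q i}"
  have "measure_pmf.prob (Pi_pmf A False (\<lambda>_. coin)) (?E T) =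
      measure_pmf.prob (Pi_pmf (S \<times> T) False (\<lambda>_. coin)) (?E T)"
    using assms(1,4) by (subst (2) Pi_pmf_subset) (auto intro!: arg_cong[of _ _ "measure_pmf.prob _"])
  also have "\<dots> = (1 - (1 / 2) ^ card S) ^ card T"
    using assms(3)
  proof (induction T)
    case (insert j T)
    let ?P = "pair_pmf (Pi_pmf (S \<times> {j}) False (\<lambda>_. coin)) (Pi_pmf (S \<times> T) False (\<lambda>_. coin))"
    have "S \<times> insert j T = (S \<times> {j}) \<union> (S \<times> T)" by auto
    then have "measure_pmf.prob (Pi_pmf (S \<times> insert j T) False (\<lambda>_. coin)) (?E (insert j T)) =
        measure_pmf.prob (map_pmf (\<lambda>(f, g) x. if x \<in> S \<times> {j} then f x else g x) ?P) (?E (insert j T))"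
      using insert.hyps assms(2) by (simp only:) (subst Pi_pmf_union; auto)
    also have "\<dots> = measure_pmf.prob ?P (?E {j} \<times> ?E T)"
      unfolding measure_map_pmf using insert.hyps(2)
      by (intro arg_cong[of _ _ "measure_pmf.prob _"]) (auto split: if_splits; metis)
    also have "\<dots> = (1 - (1 / 2) ^ card S) * (1 - (1 / 2) ^ card S) ^ card T"
      using prob_Pi_coin_block[OF assms(2), of j q] insert.IH by (simp add: prob_pair_Times)
    finally show ?case using insert.hyps by simp
  qed simp
  finally show ?thesis .
qed

text \<open>The inner power with exponent \<open>2 ^ m\<close> is at most 1/e, hence at most 1/2,
  and the remaining exponent \<open>2 ^ (m - 1)\<close> is at least \<open>m + 1\<close>. This last
  inequality fails for \<open>m = 1\<close> and \<open>m = 2\<close>, which are computed directly;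
  for \<open>m = 1\<close> the bound is attained.\<close>

lemma covering_bound:
  assumes "m \<ge> 1"
  shows "2 ^ m * (1 - (1 / 2) ^ m) ^ (2 ^ (2 * m - 1)) \<le> (1 / 2 :: real)"
proof -
  consider "m = 1" | "m = 2" | "m \<ge> 3" using assms by linarith
  then show ?thesis
  proof cases
    case 3
    have "(1 - 1 / real (2 ^ m)) ^ (2 ^ m) \<le> exp (- 1)"
      using exp_ge_one_minus_x_over_n_power_n[of 1 "2 ^ m"] by simp
    also have "\<dots> \<le> (1 / 2 :: real)"
      using exp_ge_add_one_self[of 1] by (simp add: exp_minus field_simps)
    finally have 1: "(1 - (1 / 2) ^ m) ^ (2 ^ m) \<le> (1 / 2 :: real)" by (simp add: power_divide)
    have 2: "m + 1 \<le> 2 ^ (m - 1)"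
      using 3
    proof (induction m rule: dec_induct)
      case (step n)
      then show ?case by (cases n) auto
    qed simp
    have "(2::nat) ^ (2 * m - 1) = 2 ^ m * 2 ^ (m - 1)"
      using 3 by (simp flip: power_add add: mult_2)
    then have "(1 - (1 / 2) ^ m) ^ (2 ^ (2 * m - 1)) =
        (((1 - (1 / 2) ^ m) ^ (2 ^ m)) ^ (2 ^ (m - 1)) :: real)"
      by (simp add: power_mult)
    also have "\<dots> \<le> (1 / 2) ^ (2 ^ (m - 1))"
      using 1 by (intro power_mono) (auto simp: power_le_one)
    also have "\<dots> \<le> (1 / 2) ^ (m + 1)"
      using 2 by (intro power_decreasing) auto
    finally have "2 ^ m * (1 - (1 / 2) ^ m) ^ (2 ^ (2 * m - 1)) \<le> 2 ^ m * ((1 / 2) ^ (m + 1) :: real)"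
      by (intro mult_left_mono) auto
    then show ?thesis by (simp add: power_divide)
  qed (simp_all add: power_numeral_reduce power_divide)
qed

text \<open>The index set \<open>A\<close> may exceed the matrix because coins are also tossed at
  row ends.\<close>

lemma prob_VC_mask_mat:
  assumes "contains_biclique {..<dim_row G} {..<dim_col G} (edges G) d (2 ^ d)" "d > 0"
    and "finite A" "{..<dim_row G} \<times> {..<dim_col G} \<subseteq> A"
  shows "measure_pmf.prob (Pi_pmf A False (\<lambda>_. coin))
     {f. real d / 2 \<le> real (VC (points (mask_mat G f)) (concepts (mask_mat G f)))} \<ge> 1 / 2"
proof -
  \<comment> \<open>This is d/2 rounded up, so \<open>d\<close> is \<open>2 * m - 1\<close> or
    \<open>2 * m\<close>.\<close>
  define m where "m = (d + 1) div 2"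
  have m: "m \<ge> 1" "m \<le> d" "2 * m - 1 \<le> d" "real d / 2 \<le> real m"
    using assms(2) by (auto simp: m_def)
  obtain S0 T where ST: "S0 \<subseteq> {..<dim_row G}" "T \<subseteq> {..<dim_col G}" "finite S0" "finite T"
    "card S0 = d" "card T = 2 ^ d" "\<forall>i\<in>S0. \<forall>j\<in>T. (i, j) \<in> edges G"
    using assms(1) by (auto simp: contains_biclique_def)
  obtain S where S: "S \<subseteq> S0" "card S = m" "finite S"
    using obtain_subset_with_card_n[of m S0] ST(5) m(2) by auto
  let ?P = "Pi_pmf A False (\<lambda>_. coin)"
  define good where "good =
    {f. real d / 2 \<le> real (VC (points (mask_mat G f)) (concepts (mask_mat G f)))}"
  \<comment> \<open>No column of \<open>T\<close> loses exactly the edges to \<open>Q\<close> among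
    its edges to \<open>S\<close>.\<close>
  define bad where "bad Q = {f. \<forall>j\<in>T. \<exists>i\<in>S. f (i, j) \<noteq> (i \<in> Q)}" for Q
  have "- good \<subseteq> (\<Union>Q\<in>Pow S. bad Q)"
  proof
    fix f assume f: "f \<in> - good"
    show "f \<in> (\<Union>Q\<in>Pow S. bad Q)"
    proof (rule ccontr)
      assume "f \<notin> (\<Union>Q\<in>Pow S. bad Q)"
      then have "\<And>Q. Q \<subseteq> S \<Longrightarrow> \<exists>j\<in>T. \<forall>i\<in>S. f (i, j) = (i \<in> Q)" by (auto simp: bad_def)
      then have "m \<le> VC (points (mask_mat G f)) (concepts (mask_mat G f))"
        using card_le_VC_mask_mat[of S G T f] ST(1,2,7) S by (simp add: subset_iff)
      with m(4) f show False by (auto simp: good_def)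
    qed
  qed
  then have "measure_pmf.prob ?P (- good) \<le> measure_pmf.prob ?P (\<Union>Q\<in>Pow S. bad Q)"
    by (intro measure_pmf.finite_measure_mono) auto
  also have "\<dots> \<le> (\<Sum>Q\<in>Pow S. measure_pmf.prob ?P (bad Q))"
    using S(3) by (intro measure_pmf.finite_measure_subadditive_finite) auto
  also have "\<dots> = (\<Sum>Q\<in>Pow S. (1 - (1 / 2) ^ m) ^ (2 ^ d))"
  proof (intro sum.cong refl)
    have "S \<times> T \<subseteq> A" using S(1) ST(1,2) assms(4) by blast
    then show "measure_pmf.prob ?P (bad Q) = (1 - (1 / 2) ^ m) ^ (2 ^ d)" for Q
      using prob_Pi_coin_avoid[OF assms(3) S(3) ST(4)] by (simp add: bad_def S(2) ST(6))
  qed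
  also have "\<dots> = 2 ^ m * (1 - (1 / 2) ^ m) ^ (2 ^ d)"
    using S by (simp add: card_Pow)
  also have "\<dots> \<le> 2 ^ m * (1 - (1 / 2) ^ m) ^ (2 ^ (2 * m - 1))"
    using m(3) by (intro mult_left_mono power_decreasing power_increasing) (auto simp: power_le_one)
  also have "\<dots> \<le> 1 / 2" using covering_bound m(1) .
  finally have "measure_pmf.prob ?P (- good) \<le> 1 / 2" .
  then show ?thesis
    using measure_pmf.prob_compl[of good ?P] by (simp add: good_def Compl_eq_Diff_UNIV)
qed

section \<open>Masking the code of a matrix\<close>

text \<open>The extra column index \<open>dim_col G\<close> stands for the row end, so that every
  symbol of the code has its own index.\<close>

definition cells :: "bool mat \<Rightarrow> (nat \<times> nat) list" where
  "cells G = List.product [0..<dim_row G] [0..<Suc (dim_col G)]"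

definition cell_symbol :: "bool mat \<Rightarrow> nat \<times> nat \<Rightarrow> nat" where
  "cell_symbol G x = (if snd x = dim_col G then 3 else if G $$ x then 2 else 1)"

lemma encode_eq: "encode G = map (cell_symbol G) (cells G)"
proof -
  have "map (\<lambda>j. cell_symbol G (i, j)) [0..<dim_col G] =
      map (\<lambda>j. if G $$ (i, j) then 2 else 1) [0..<dim_col G]" for i
    by (intro map_cong) (auto simp: cell_symbol_def)
  moreover have "cell_symbol G (i, dim_col G) = 3" for i
    by (simp add: cell_symbol_def)
  ultimately show ?thesis
    by (simp add: encode_def cells_def product_concat_map map_concat o_def del: map_eq_conv)
qed

lemma set_cells: "set (cells G) = {..<dim_row G} \<times> {..dim_col G}"
  by (auto simp: cells_def)

lemma distinct_cells: "distinct (cells G)"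
  by (simp add: cells_def distinct_product)

text \<open>Successive independent tosses are the coordinates of a product measure; distinctness
  gives each position its own coordinate.\<close>

lemma mask_word_map:
  assumes "distinct xs"
  shows "mask_word msk (map g xs) =
    map_pmf (\<lambda>f. map (\<lambda>x. mask_symbol msk (f x) (g x)) xs) (Pi_pmf (set xs) False (\<lambda>_. coin))"
  using assms
proof (induction xs)
  case (Cons x xs)
  have *: "map (\<lambda>y. mask_symbol msk ((f(x := r)) y) (g y)) xs = map (\<lambda>y. mask_symbol msk (f y) (g y)) xs"
    for f r using Cons.prems by auto
  show ?case using Cons
    by (simp add: Pi_pmf_insert' map_bind_pmf map_pmf_comp * del: fun_upd_apply)
       (simp add: map_pmf_def bind_return_pmf bind_assoc_pmf)
qed simp

text \<open>Each symbol depends only on its own coin, so it can be compared under a constant mask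
  first. Coins at row ends are tossed and ignored.\<close>

lemma mask_word_encode:
  "mask_word True (encode G) =
     map_pmf (\<lambda>f. encode (mask_mat G f)) (Pi_pmf (set (cells G)) False (\<lambda>_. coin))"
proof -
  have "mask_symbol True r (cell_symbol G x) = cell_symbol (mask_mat G (\<lambda>_. r)) x"
    if "x \<in> set (cells G)" for x r
    using that by (auto simp: set_cells le_less mask_symbol_def cell_symbol_def mask_mat_def)
  moreover have "cell_symbol (mask_mat G (\<lambda>_. f x)) x = cell_symbol (mask_mat G f) x"
    if "x \<in> set (cells G)" for x f
    using that by (auto simp: set_cells le_less cell_symbol_def mask_mat_def)
  moreover have "cells (mask_mat G f) = cells G" for f by (simp add: cells_def)
  ultimately show ?thesis
    by (simp add: encode_eq mask_word_map distinct_cells cong: map_cong)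
qed

lemma mask_word_False: "mask_word False w = return_pmf w"
  by (induction w) (simp_all add: mask_symbol_def)

lemma length_encode:
  assumes "dim_col G > 0"
  shows "length (encode G) \<le> 2 * inst_size G"
  using assms by (simp add: encode_eq cells_def length_concat o_def inst_size_def sum_list_triv)

lemma encode_Nil_iff: "encode G = [] \<longleftrightarrow> dim_row G = 0"
  by (auto simp: encode_def)

lemma hd_encode:
  "dim_row G > 0 \<Longrightarrow> hd (encode G) = (if dim_col G = 0 then 3 else if G $$ (0, 0) then 2 else 1)"
  by (auto simp: encode_def upt_rec[of 0])

lemma set_encode: "set (encode G) \<subseteq> {1, 2, 3}"
  by (auto simp: encode_def)

section \<open>The reduction\<close>

lemma expectation_ge_prob:
  fixes h :: "'a \<Rightarrow> real"
  assumes "\<And>x. x \<in> A \<Longrightarrow> a \<le> h x" "\<And>x. 0 \<le> h x" "\<And>x. h x \<le> 1"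
  shows "a * measure_pmf.prob P A \<le> measure_pmf.expectation P h"
proof -
  have "a * measure_pmf.prob P A = measure_pmf.expectation P (\<lambda>x. a * indicator A x)"
    by simp
  also have "\<dots> \<le> measure_pmf.expectation P h"
  proof (rule integral_mono)
    show "integrable (measure_pmf P) (\<lambda>x. a * indicator A x)"
      by (intro measure_pmf.integrable_const_bound[of _ "\<bar>a\<bar>"]) (auto simp: indicator_def)
    show "integrable (measure_pmf P) h"
      using assms(2,3) by (intro measure_pmf.integrable_const_bound[of _ 1]) auto
  qed (use assms(1,2) in \<open>auto simp: indicator_def\<close>)
  finally show ?thesis .
qed

lemma pmf_bind_ge:
  assumes "\<And>x. x \<in> A \<Longrightarrow> a \<le> pmf (F x) y"
  shows "a * measure_pmf.prob P A \<le> pmf (bind_pmf P F) y"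
  unfolding pmf_bind using assms by (intro expectation_ge_prob) (auto simp: pmf_le_1)

lemma pmf_bind_le:
  assumes "\<And>x. pmf (F x) y \<le> a"
  shows "pmf (bind_pmf P F) y \<le> a"
  unfolding pmf_bind
  by (intro measure_pmf.integral_le_const measure_pmf.integrable_const_bound[of _ 1])
    (use assms in \<open>auto simp: pmf_le_1\<close>)

lemma pmf_bool_False: "pmf D False = 1 - pmf D True"
proof -
  have "(\<Sum>x\<in>UNIV. pmf D x) = 1" by (intro sum_pmf_eq_1) auto
  then show ?thesis by (simp add: UNIV_bool)
qed

lemma pmf_bind_bool:
  "pmf (bind_pmf D F) y = pmf D True * pmf (F True) y + pmf D False * pmf (F False) y"
  unfolding pmf_bind by (subst integral_measure_pmf[of UNIV]) (auto simp: UNIV_bool)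

text \<open>Halting states are absorbing, so mass that has reached \<open>q\<close> stays
  there.\<close>

lemma prob_run_mono:
  assumes "q = yes_state M \<or> q = no_state M" "k \<le> n"
  shows "measure_pmf.prob (run M k c) {c. fst c = q} \<le> measure_pmf.prob (run M n c) {c. fst c = q}"
proof -
  have eq: "measure_pmf.prob P {c. fst c = q} = pmf (map_pmf fst P) q" for P :: "config pmf"
    by (simp add: pmf_map vimage_def)
  have "1 * measure_pmf.prob (run M k c) {c. fst c = q} \<le>
      pmf (bind_pmf (run M k c) (\<lambda>c'. map_pmf fst (run M (n - k) c'))) q"
    using assms(1) by (intro pmf_bind_ge) (auto simp: run_halted halted_def)
  also have "bind_pmf (run M k c) (\<lambda>c'. map_pmf fst (run M (n - k) c')) = map_pmf fst (run M n c)"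
    using assms(2) run_add[of M k "n - k" c] by (simp add: map_bind_pmf)
  finally show ?thesis by (simp add: eq)
qed

text \<open>By monotonicity the supremum over time is already attained at \<open>t\<close>.\<close>

lemma prob_halt_in_decides:
  assumes "yes_state M \<noteq> no_state M" "decides M (init_config M (encode G)) t D"
  shows "prob_halt_in M G (answer_state M b) = pmf D b"
proof -
  let ?p = "\<lambda>k. measure_pmf.prob (run M k (init_config M (encode G))) {c. fst c = answer_state M b}"
  have inj: "inj (answer_state M)"
    using assms(1) by (auto simp: inj_def answer_state_def)
  have late: "?p k = pmf D b" if "k \<ge> t" for k
  proof -
    have "?p k = pmf (map_pmf fst (run M k (init_config M (encode G)))) (answer_state M b)"
      by (simp add: pmf_map vimage_def)
    also have "\<dots> = pmf D b"
      using assms(2) that inj by (simp add: decides_def pmf_map_inj')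
    finally show ?thesis .
  qed
  have le: "?p k \<le> pmf D b" for k
    using prob_run_mono[of "answer_state M b" M k "max k t" "init_config M (encode G)"]
      late[of "max k t"] by (auto simp: answer_state_def)
  show ?thesis unfolding prob_halt_in_def
  proof (rule antisym)
    show "(SUP k. ?p k) \<le> pmf D b" using le by (intro cSUP_least) auto
    show "pmf D b \<le> (SUP k. ?p k)"
      using le by (subst late[of t, symmetric, OF order_refl])
        (intro cSUP_upper bdd_aboveI[of _ "pmf D b"], auto)
  qed
qed

lemma decides_of_halted:
  assumes "yes_state M \<noteq> no_state M" "\<forall>c'\<in>set_pmf (run M t c). halted M c'"
  shows "decides M c t (map_pmf (\<lambda>c'. fst c' = yes_state M) (run M t c))"
  unfolding decides_def
proof (intro allI impI)
  fix n assume "t \<le> n"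
  then have "run M n c = bind_pmf (run M t c) (run M (n - t))"
    using run_add[of M t "n - t"] by simp
  also have "\<dots> = bind_pmf (run M t c) return_pmf"
    using assms(2) by (intro bind_pmf_cong) (auto simp: run_halted)
  finally have "run M n c = run M t c" by (simp add: bind_return_pmf')
  then show "map_pmf fst (run M n c) =
      map_pmf (answer_state M) (map_pmf (\<lambda>c'. fst c' = yes_state M) (run M t c))"
    using assms by (auto simp: pmf.map_comp halted_def answer_state_def intro!: map_pmf_cong)
qed

lemma solves_iff_decides:
  assumes "yes_state M \<noteq> no_state M"
    and "\<And>G. decides M (init_config M (encode G)) (t G) (D G)"
  shows "solves M P \<longleftrightarrow>
    (\<forall>G\<in>Yes P. 2 / 3 \<le> pmf (D G) True) \<and> (\<forall>G\<in>No P. 2 / 3 \<le> pmf (D G) False)"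
proof -
  have "prob_halt_in M G (yes_state M) = pmf (D G) True"
    "prob_halt_in M G (no_state M) = pmf (D G) False" for G
    using prob_halt_in_decides[OF assms, of G True] prob_halt_in_decides[OF assms, of G False]
    by (simp_all add: answer_state_def)
  then show ?thesis by (simp add: solves_def)
qed

text \<open>
  Three unanimous runs on one common masked matrix are accepted with probability at least
  \<open>(2/3)^3 / 2 = 4/27\<close> on YES instances and at most \<open>(1/3)^3 = 1/27\<close> on NO instances. The
  disjunction of seven such tests succeeds, since \<open>(23/27)^7 \<le> 1/3\<close> and \<open>(26/27)^7 \<ge> 2/3\<close>. With
  fresh masks for every single run, the two cases could not be told apart for \<open>d1 = 1\<close>, where the
  mask succeeds with probability exactly 1/2 and both acceptance bounds become 1/3.
\<close>

definition masked_test :: "tm \<Rightarrow> tm" where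
  "masked_test M = chain True False M (chain False False M M)"

primrec repeated_test :: "tm \<Rightarrow> nat \<Rightarrow> tm" where
  "repeated_test M 0 = masked_test M"
| "repeated_test M (Suc k) = chain False True (masked_test M) (repeated_test M k)"

lemma wf_repeated_test: "wf_tm M \<Longrightarrow> wf_tm (repeated_test M k)"
  by (induction k) (simp_all add: masked_test_def wf_chain)

text \<open>Written in the form that \<open>decides_chain\<close> produces for
  \<open>b = False\<close>, nested twice.\<close>

definition unanimous :: "bool pmf \<Rightarrow> bool pmf" where
  "unanimous P = bind_pmf P (\<lambda>x. if x = False then return_pmf False else
     bind_pmf P (\<lambda>x. if x = False then return_pmf False else P))"

lemma pmf_unanimous: "pmf (unanimous P) True = pmf P True ^ 3"
  by (simp add: unanimous_def pmf_bind_bool power3_eq_cube)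

definition masked_dist :: "(nat list \<Rightarrow> bool pmf) \<Rightarrow> nat list \<Rightarrow> bool pmf" where
  "masked_dist D w = bind_pmf (mask_word True w) (\<lambda>u. unanimous (D u))"

primrec repeated_dist :: "(nat list \<Rightarrow> bool pmf) \<Rightarrow> nat list \<Rightarrow> nat \<Rightarrow> bool pmf" where
  "repeated_dist D w 0 = masked_dist D w"
| "repeated_dist D w (Suc k) = bind_pmf (masked_dist D w) (\<lambda>x.
     if x = True then return_pmf True else repeated_dist D w k)"

lemma pmf_repeated_dist:
  "pmf (repeated_dist D w k) False = (1 - pmf (masked_dist D w) True) ^ Suc k"
  by (induction k) (simp_all add: pmf_bind_bool pmf_bool_False[of "masked_dist D w"])

section \<open>Running time and error of the repeated test\<close>

context
  fixes M :: tm and G :: "bool mat" and t :: nat and D :: "nat list \<Rightarrow> bool pmf"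
  assumes wf: "wf_tm M" and row: "dim_row G > 0" and col: "dim_col G > 0"
    and dec: "\<And>f. decides M (init_config M (encode (mask_mat G f))) t (D (encode (mask_mat G f)))"
begin

lemma encode_Cons:
  assumes "dim_row H = dim_row G" "dim_col H = dim_col G"
  obtains a v where "encode H = a # v" "a = 1 \<or> a = 2"
  using assms row col encode_Nil_iff[of H] hd_encode[of H]
  by (cases "encode H") (auto split: if_splits)

lemma length_encode_mask_mat: "length (encode (mask_mat G f)) = length (encode G)"
  by (simp add: encode_eq cells_def)

text \<open>Only the outer chain masks; the inner one copies faithfully, so all three runs of
  \<open>M\<close> see the same masked matrix. Each chain costs
  \<open>2 * length (encode G) + 5\<close> steps of its own.\<close>

lemma decides_masked_test:
  "decides (masked_test M) (init_config (masked_test M) (encode G))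
     (3 * t + 4 * length (encode G) + 10) (masked_dist D (encode G))"
proof -
  let ?L = "length (encode G)"
  let ?N = "chain False False M M"
  have "decides ?N (init_config ?N (encode (mask_mat G f))) (2 * ?L + 3 + (t + t + 2))
      (bind_pmf (D (encode (mask_mat G f)))
        (\<lambda>x. if x = False then return_pmf False else D (encode (mask_mat G f))))" for f
  proof -
    let ?H = "mask_mat G f"
    obtain a v where av: "encode ?H = a # v" "a = 1 \<or> a = 2"
      using encode_Cons[of ?H] by auto
    show ?thesis
      using decides_chain[OF wf wf av set_encode, of False t D t D False] dec
      by (simp add: mask_word_False bind_return_pmf length_encode_mask_mat)
  qed
  then have inner: "decides ?N (init_config ?N u) (2 * ?L + 3 + (t + t + 2))
      (bind_pmf (D u) (\<lambda>x. if x = False then return_pmf False else D u))"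
    and outer: "decides M (init_config M u) t (D u)"
    if "u \<in> set_pmf (mask_word True (encode G))" for u
    using that dec unfolding mask_word_encode set_map_pmf by blast+
  obtain a v where av: "encode G = a # v" "a = 1 \<or> a = 2"
    using encode_Cons[of G] by auto
  have "decides (masked_test M) (init_config (masked_test M) (encode G))
     (2 * ?L + 3 + (t + (2 * ?L + 3 + (t + t + 2)) + 2)) (masked_dist D (encode G))"
    unfolding masked_test_def masked_dist_def unanimous_def
    by (rule decides_chain[OF wf wf_chain[OF wf wf] av set_encode outer inner])
  then show ?thesis by (rule decides_mono) simp
qed

lemma decides_repeated_test:
  "decides (repeated_test M k) (init_config (repeated_test M k) (encode G))
     (Suc k * (3 * t + 6 * length (encode G) + 15)) (repeated_dist D (encode G) k)"
proof (induction k)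
  case 0
  show ?case using decides_masked_test by (auto intro: decides_mono)
next
  case (Suc k)
  let ?L = "length (encode G)"
  obtain a v where "encode G = a # v" "a = 1 \<or> a = 2"
    using encode_Cons[of G] by auto
  note chain = decides_chain[OF wf_repeated_test[OF wf, of 0] wf_repeated_test[OF wf, of k] this
      set_encode,
      of False "3 * t + 4 * ?L + 10" "masked_dist D" "Suc k * (3 * t + 6 * ?L + 15)"
      "\<lambda>w. repeated_dist D w k" True]
  have "decides (repeated_test M (Suc k)) (init_config (repeated_test M (Suc k)) (encode G))
     (2 * ?L + 3 + (3 * t + 4 * ?L + 10 + Suc k * (3 * t + 6 * ?L + 15) + 2))
     (repeated_dist D (encode G) (Suc k))"
    using chain decides_masked_test Suc by (simp add: mask_word_False bind_return_pmf)
  then show ?case by (rule decides_mono) simp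
qed

text \<open>A mask with too small VC dimension may violate the promise, so \<open>D\<close> is
  unknown there and such masks are credited with acceptance probability 0.\<close>

lemma repeated_dist_accepts:
  assumes "contains_biclique {..<dim_row G} {..<dim_col G} (edges G) d (2 ^ d)" "d > 0"
    and "\<And>f. real d / 2 \<le> real (VC (points (mask_mat G f)) (concepts (mask_mat G f))) \<Longrightarrow>
           2 / 3 \<le> pmf (D (encode (mask_mat G f))) True"
  shows "2 / 3 \<le> pmf (repeated_dist D (encode G) 6) True"
proof -
  let ?P = "Pi_pmf (set (cells G)) False (\<lambda>_. coin)"
  let ?good = "{f. real d / 2 \<le> real (VC (points (mask_mat G f)) (concepts (mask_mat G f)))}"
  have "1 / 2 \<le> measure_pmf.prob ?P ?good"
    using assms(1,2) by (intro prob_VC_mask_mat) (auto simp: set_cells)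
  then have "4 / 27 \<le> 8 / 27 * measure_pmf.prob ?P ?good" by simp
  also have "\<dots> \<le> pmf (bind_pmf ?P (\<lambda>f. unanimous (D (encode (mask_mat G f))))) True"
  proof (rule pmf_bind_ge)
    fix f assume "f \<in> ?good"
    then have "(2 / 3) ^ 3 \<le> pmf (D (encode (mask_mat G f))) True ^ 3"
      using assms(3) by (intro power_mono) auto
    then show "8 / 27 \<le> pmf (unanimous (D (encode (mask_mat G f)))) True"
      by (simp add: pmf_unanimous power3_eq_cube)
  qed
  also have "\<dots> = pmf (masked_dist D (encode G)) True"
    by (simp add: masked_dist_def mask_word_encode bind_map_pmf)
  finally have "pmf (repeated_dist D (encode G) 6) False \<le> (1 - 4 / 27) ^ Suc 6"
    unfolding pmf_repeated_dist by (intro power_mono) (auto simp: pmf_le_1)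
  also have "\<dots> \<le> (1 / 3 :: real)" by (simp add: power_numeral_reduce)
  finally show ?thesis by (simp add: pmf_bool_False)
qed

text \<open>The error bound holds for every mask and therefore survives averaging.\<close>

lemma repeated_dist_rejects:
  assumes "\<And>f. 2 / 3 \<le> pmf (D (encode (mask_mat G f))) False"
  shows "2 / 3 \<le> pmf (repeated_dist D (encode G) 6) False"
proof -
  let ?P = "Pi_pmf (set (cells G)) False (\<lambda>_. coin)"
  have "pmf (masked_dist D (encode G)) True =
      pmf (bind_pmf ?P (\<lambda>f. unanimous (D (encode (mask_mat G f))))) True"
    by (simp add: masked_dist_def mask_word_encode bind_map_pmf)
  also have "\<dots> \<le> 1 / 27"
  proof (rule pmf_bind_le)
    fix f
    have "pmf (D (encode (mask_mat G f))) True ^ 3 \<le> (1 / 3) ^ 3"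
      using assms[of f] by (intro power_mono) (auto simp: pmf_bool_False)
    then show "pmf (unanimous (D (encode (mask_mat G f)))) True \<le> 1 / 27"
      by (simp add: pmf_unanimous power3_eq_cube)
  qed
  finally have "(1 - 1 / 27) ^ Suc 6 \<le> pmf (repeated_dist D (encode G) 6) False"
    unfolding pmf_repeated_dist by (intro power_mono) auto
  moreover have "2 / 3 \<le> ((1 - 1 / 27) ^ Suc 6 :: real)" by (simp add: power_numeral_reduce)
  ultimately show ?thesis by linarith
qed

end

lemma repeated_test_rejects:
  assumes "wf_tm M" "dim_row G = 0 \<or> dim_col G = 0"
  shows "decides (repeated_test M k) (init_config (repeated_test M k) (encode G)) 1
      (return_pmf False)"
proof -
  have "encode G = [] \<or> hd (encode G) = 3"
    using assms(2) encode_Nil_iff[of G] hd_encode[of G] by auto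
  then have "decides (chain msk b M1 M2) (init_config (chain msk b M1 M2) (encode G)) 1
      (return_pmf False)"
    if "wf_tm M1" "wf_tm M2" for msk b M1 M2
    using decides_chain_reject that by blast
  from this[of M "chain False False M M"] this[of "masked_test M" "repeated_test M (k - 1)"]
  show ?thesis
    using assms(1) wf_chain wf_repeated_test[of M] wf_repeated_test[of M 0]
    by (cases k) (simp_all add: masked_test_def)
qed

theorem theorem12:
  fixes d1 d2 T :: "nat \<Rightarrow> nat"
  assumes "\<And>n. d1 n > 0" and "\<And>n. d2 n > 0"
    and "(\<lambda>n. real (T n)) \<in> \<Omega>(\<lambda>n. real n)"
    and "solvable_in_time (vc_ldim_problem (\<lambda>n. real (d1 n) / 2) (\<lambda>n. 2 * real (d2 n))) T"
  shows "\<exists>T'. (\<lambda>n. real (T' n)) \<in> O(\<lambda>n. real (T n)) \<and>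
           solvable_in_time (gap_exp_biclique_problem d1 d2) T'"
proof -
  obtain M where M: "wf_tm M" "runs_in_time M T"
      "solves M (vc_ldim_problem (\<lambda>n. real (d1 n) / 2) (\<lambda>n. 2 * real (d2 n)))"
    using assms(4) by (auto simp: solvable_in_time_def)
  have neq: "yes_state M \<noteq> no_state M" using M(1) by (simp add: wf_tm_def)
  \<comment> \<open>Masking preserves the size, so one time bound and one function of the code serve
    all masks of a matrix.\<close>
  define DM where "DM n w =
    map_pmf (\<lambda>c. fst c = yes_state M) (run M (T n) (init_config M w))" for n w
  have dec: "decides M (init_config M (encode G)) (T (inst_size G))
      (DM (inst_size G) (encode G))" for G
    using decides_of_halted neq M(2) by (simp add: DM_def runs_in_time_def)
  have yes: "2 / 3 \<le> pmf (DM (inst_size G) (encode G)) True"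
    if "real (d1 (inst_size G)) / 2 \<le> real (VC (points G) (concepts G))" for G
    using that M(3) unfolding solves_iff_decides[OF neq dec] by (simp add: vc_ldim_problem_def)
  have no: "2 / 3 \<le> pmf (DM (inst_size G) (encode G)) False"
    if "Ldim (points G) (concepts G) < 2 * d2 (inst_size G)" for G
    using that M(3) unfolding solves_iff_decides[OF neq dec]
    by (simp add: vc_ldim_problem_def flip: of_nat_less_iff)
  define N where "N = repeated_test M 6"
  \<comment> \<open>There are seven rounds, and \<open>6 * length (encode G)\<close> is at most
    \<open>12 * n\<close> if there is a column.\<close>
  define T' where "T' n = 7 * (3 * T n + 12 * n + 15)" for n
  define DN where "DN G = (if dim_row G = 0 \<or> dim_col G = 0 then return_pmf False
     else repeated_dist (DM (inst_size G)) (encode G) 6)" for G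
  have wfN: "wf_tm N" using M(1) by (simp add: N_def wf_repeated_test)
  have neqN: "yes_state N \<noteq> no_state N" using wfN by (simp add: wf_tm_def)
  have dec_mask: "decides M (init_config M (encode (mask_mat G f))) (T (inst_size G))
      (DM (inst_size G) (encode (mask_mat G f)))" for G f
    using dec[of "mask_mat G f"] by simp
  have decN: "decides N (init_config N (encode G)) (T' (inst_size G)) (DN G)" for G
  proof (cases "dim_row G = 0 \<or> dim_col G = 0")
    case True
    then show ?thesis
      using repeated_test_rejects[OF M(1), of G 6]
      by (auto simp: N_def DN_def T'_def intro: decides_mono)
  next
    case False
    then show ?thesis
      using decides_repeated_test[OF M(1) _ _ dec_mask, of G 6] length_encode[of G]
      by (auto simp: N_def DN_def T'_def intro: decides_mono)
  qed
  have "runs_in_time N T'"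
    using decides_halts[OF decN] by (auto simp: runs_in_time_def)
  moreover have "solves N (gap_exp_biclique_problem d1 d2)"
    unfolding solves_iff_decides[OF neqN decN]
  proof (intro conjI ballI)
    fix G assume "G \<in> Yes (gap_exp_biclique_problem d1 d2)"
    then have G: "contains_biclique {..<dim_row G} {..<dim_col G} (edges G)
        (d1 (inst_size G)) (2 ^ d1 (inst_size G))"
      by (simp add: gap_exp_biclique_problem_def)
    \<comment> \<open>As \<open>d1\<close> is positive, a YES instance has a row and a column and
      thus escapes the immediate rejection in \<open>DN\<close>.\<close>
    then obtain S T where "S \<subseteq> {..<dim_row G}" "card S = d1 (inst_size G)"
        "T \<subseteq> {..<dim_col G}" "card T = 2 ^ d1 (inst_size G)"
      by (auto simp: contains_biclique_def)
    then have "0 < card {..<dim_row G}" "0 < card {..<dim_col G}"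
      using assms(1)[of "inst_size G"] card_mono[of "{..<dim_row G}" S]
        card_mono[of "{..<dim_col G}" T] less_le_trans[of 0 "2 ^ d1 (inst_size G)" "dim_col G"]
      by auto
    then have "dim_row G \<noteq> 0" "dim_col G \<noteq> 0" by simp_all
    then show "2 / 3 \<le> pmf (DN G) True"
      using repeated_dist_accepts[OF M(1) _ _ dec_mask G assms(1)] yes[of "mask_mat G f" for f]
      by (simp add: DN_def)
  next
    fix G assume "G \<in> No (gap_exp_biclique_problem d1 d2)"
    then have "Ldim (points (mask_mat G f)) (concepts (mask_mat G f)) < 2 * d2 (inst_size G)" for f
      using Ldim_mask_mat_less assms(2) by (simp add: gap_exp_biclique_problem_def)
    then show "2 / 3 \<le> pmf (DN G) False"
      using repeated_dist_rejects[OF M(1) _ _ dec_mask] no[of "mask_mat G f" for f]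
      by (simp add: DN_def)
  qed
  ultimately have "solvable_in_time (gap_exp_biclique_problem d1 d2) T'"
    using wfN by (auto simp: solvable_in_time_def)
  moreover have "(\<lambda>n. real (T' n)) \<in> O(\<lambda>n. real (T n))"
  proof -
    have n: "(\<lambda>n. real n) \<in> O(\<lambda>n. real (T n))"
      using assms(3) by (simp add: bigomega_iff_bigo)
    \<comment> \<open>The lower bound on \<open>T\<close> absorbs the copying cost and the additive
      constant.\<close>
    have "(\<lambda>n. 1 :: real) \<in> O(\<lambda>n. real n)"
      by (intro bigoI[of _ 1] eventually_mono[OF eventually_ge_at_top[of 1]]) auto
    then have "(\<lambda>n. 1 :: real) \<in> O(\<lambda>n. real (T n))"
      using n landau_o.big_trans by blast
    then have "(\<lambda>n. 21 * real (T n) + 84 * real n + 105 * 1) \<in> O(\<lambda>n. real (T n))"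
      using n by (intro sum_in_bigo) (simp_all del: mult_1_right)
    then show ?thesis by (simp add: T'_def algebra_simps)
  qed
  ultimately show ?thesis by blast
qed

end
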